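(* Let $1\le r<d$ be integers, let $A=(A(1),\dots,A(d))$ and $B=(B(1),\dots,B(r))$ be tuples of non-negative real numbers, and put $D=d+\sum_{j=1}^dA(j)$, $D_r=r+\sum_{i=1}^rB(i)$. Let $1\le p<D$ and $$q=\frac{p\,D_r}{D-p}.$$ Let $W=W_{A,B}(p,q;r,d)$ be the optimal (minimal) constant in the inequality $$\left[\int_0^\infty\rho^{D_r-1}|u(\rho)|^q\,d\rho\right]^{1/q}\le W\left[\int_0^\infty\rho^{D-1}|u'(\rho)|^p\,d\rho\right]^{1/p}$$ over radial functions $u(z)=u(|z|)$. Then $$M\le W\le M\cdot Q,$$ where $$M=D_r^{-1/q}\left(\frac{p-1}{D-p}\right)^{1-1/p},\qquad Q=\left(\frac{q}{q-1}\right)^{1-1/p}q^{1/q}.$$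
   Context: The one-dimensional inequality is the form taken, for radial functions $u(z)=u(|z|)$ on $\mathbb{R}^d$ (with $z=(x,y)$, $x\in\mathbb{R}^r$, $y\in\mathbb{R}^{d-r}$, $|z|$ the Euclidean norm), by the monomial trace Sobolev inequality $$\left(\int_{\mathbb{R}^r}\prod_{i=1}^r|x_i|^{B(i)}\,|u(x,0)|^q\,dx\right)^{1/q}\le K^R\left(\int_{\mathbb{R}^d}\prod_{j=1}^d|z_j|^{A(j)}\,|\nabla u(z)|^p\,dz\right)^{1/p}$$ after passing to spherical coordinates and absorbing the angular integrals in the constant $W$. Here $u(\rho)$ denotes the radial profile, and the radial functions considered are those with $u\in C_0^\infty(\mathbb{R}^d)$ (infinitely differentiable with compact support).
   Formalization: For q < p no finite constant W exists (e.g. d=3, r=1, A=B=0, p=1, q=1/2: sums of disjoint dyadic dilates of a bump), so the bounds are stated for W whenever a minimal constant exists, and its existence is asserted for p ≤ q. *)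

theory Defs
  imports "HOL-Analysis.Analysis"
begin

primrec Ck :: "nat \<Rightarrow> ('a::euclidean_space \<Rightarrow> real) \<Rightarrow> bool" where
  "Ck 0 u \<longleftrightarrow> continuous_on UNIV u"
| "Ck (Suc k) u \<longleftrightarrow>
     u differentiable_on UNIV \<and> (\<forall>b\<in>Basis. Ck k (\<lambda>z. frechet_derivative u (at z) b))"

definition test_function :: "('a::euclidean_space \<Rightarrow> real) \<Rightarrow> bool" where
  "test_function u \<longleftrightarrow> (\<forall>k. Ck k u) \<and> compact (closure {z. u z \<noteq> 0})"

definition hdim :: "real ^ 'n \<Rightarrow> real" where
  "hdim A = real CARD('n) + (\<Sum>i\<in>UNIV. A $ i)"

text \<open>
  The profile \<open>f\<close> is unconstrained on the negative half-line. That is harmless: only its values and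
  derivatives at positive arguments enter. For every admissible profile both integrals converge
  whenever the components of \<open>A\<close> and \<open>B\<close> are nonnegative, \<open>p \<ge> 1\<close> and \<open>q > 0\<close>, so the value \<open>0\<close>
  given to divergent Lebesgue integrals plays no role. The type of \<open>A\<close> fixes the space on which
  the radial functions live.
\<close>

definition radial_trace_ineq :: "real ^ 'd \<Rightarrow> real ^ 'r \<Rightarrow> real \<Rightarrow> real \<Rightarrow> real \<Rightarrow> bool" where
  "radial_trace_ineq (A :: real ^ 'd) B p q C \<longleftrightarrow>
     (\<forall>f :: real \<Rightarrow> real. test_function (\<lambda>z :: real ^ 'd. f (norm z)) \<longrightarrow>
        (LBINT \<rho>:{0<..}. \<rho> powr (hdim B - 1) * \<bar>f \<rho>\<bar> powr q) powr (1 / q)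
          \<le> C * (LBINT \<rho>:{0<..}. \<rho> powr (hdim A - 1) * \<bar>deriv f \<rho>\<bar> powr p) powr (1 / p))"

definition optimal_radial_const :: "real ^ 'd \<Rightarrow> real ^ 'r \<Rightarrow> real \<Rightarrow> real \<Rightarrow> real \<Rightarrow> bool" where
  "optimal_radial_const A B p q W \<longleftrightarrow>
     radial_trace_ineq A B p q W \<and> (\<forall>C. radial_trace_ineq A B p q C \<longrightarrow> W \<le> C)"

text \<open>
  Real powers with \<open>x\<^sup>0 = 1\<close> for every base, whereas \<open>0 powr 0 = 0\<close>. For \<open>p = 1\<close> the exponent
  \<open>1 - 1/p\<close> vanishes, and the bases \<open>(p - 1) / (D - p) = 0\<close> and, if \<open>q = 1\<close>, \<open>q / (q - 1)\<close>
  (formally infinite) have to contribute the factor \<open>1\<close>.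
\<close>

definition rpow :: "real \<Rightarrow> real \<Rightarrow> real" where
  "rpow x a = (if a = 0 then 1 else x powr a)"

end

theory Submission
  imports Defs
begin

text \<open>
  The inequality is a Hardy inequality with power weights
  for the profile \<open>f\<close>, which is minus the integral of its derivative from \<open>\<rho>\<close> to infinity. For
  every \<open>r > 0\<close> the number \<open>M\<close> is the product of the two weight norms
  \<open>(\<integral> {0..r} \<rho> powr (Dr - 1)) powr (1 / q)\<close> and
  \<open>(\<integral> {r..} \<rho> powr (- (D - 1) / (p - 1))) powr (1 - 1 / p)\<close>
  (read as a limit for \<open>p = 1\<close>),
  which by the relation between \<open>p\<close> and \<open>q\<close> does not depend on \<open>r\<close>. It
  always bounds the best constant from below, and \<open>M * Q\<close> bounds it from above if
  \<open>p \<le> q\<close>.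

  Lower bound (\<open>radial_trace_const_lower_bound\<close>). A profile that is constant on \<open>{0..1}\<close>
  and decreases beyond \<open>1\<close> with the slope for which Hoelder's inequality is an equality
  produces \<open>M\<close>. Smooth compactly supported profiles approximate it; for \<open>p = 1\<close> the slope
  concentrates at \<open>1\<close>.

  Upper bound (\<open>radial_trace_ineq_upper\<close>). Hoelder's inequality with a well chosen power as
  auxiliary weight reduces the case \<open>p > 1\<close> to a Hardy inequality for an \<open>L\<^sup>1\<close> function and
  the exponent \<open>q / p \<ge> 1\<close>. That inequality (\<open>weighted_Hardy_inequality\<close>) follows by
  comparing derivatives, and the two constants multiply to \<open>M * Q\<close>.

  For \<open>q < p\<close> no constant is admissible (\<open>no_radial_trace_ineq\<close>), as sums of many disjoint
  dilates of a bump show; so an optimal constant can exist only if \<open>p \<le> q\<close>. In that case it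
  does exist, being the infimum of the admissible constants (\<open>radial_trace_ineq_Inf\<close>).
\<close>

section \<open>Smoothness of radial functions\<close>
text \<open>
  Being infinitely differentiable is a coinductive property: it suffices to exhibit a set of
  functions that contains the given one and, with each member, a derivative of it.
\<close>
definition derivative_closed :: "(real \<Rightarrow> real) set \<Rightarrow> bool" where
  "derivative_closed X \<longleftrightarrow>
     (\<forall>\<phi>\<in>X. \<exists>\<phi>'\<in>X. \<forall>t. (\<phi> has_real_derivative \<phi>' t) (at t))"

text \<open>
  The same certificate in several variables. The profile enters through \<open>z \<bullet> z\<close> and not
  through \<open>norm z\<close>, so that the origin is no exception and the partial derivatives
  \<open>2 * (z \<bullet> b) * \<phi>' (z \<bullet> z)\<close> stay inside the algebra.
\<close>
inductive_set radial_algebra :: "(real \<Rightarrow> real) set \<Rightarrow> ('a::euclidean_space \<Rightarrow> real) set"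
  for X where
  base: "\<phi> \<in> X \<Longrightarrow> (\<lambda>z. \<phi> (z \<bullet> z)) \<in> radial_algebra X"
| coord: "(\<lambda>z. z \<bullet> b) \<in> radial_algebra X"
| const: "(\<lambda>z. c) \<in> radial_algebra X"
| add: "u \<in> radial_algebra X \<Longrightarrow> v \<in> radial_algebra X \<Longrightarrow> (\<lambda>z. u z + v z) \<in> radial_algebra X"
| mult: "u \<in> radial_algebra X \<Longrightarrow> v \<in> radial_algebra X \<Longrightarrow> (\<lambda>z. u z * v z) \<in> radial_algebra X"

lemma radial_algebra_derivative:
  assumes "derivative_closed X" and "u \<in> radial_algebra X"
  shows "\<exists>u'. (\<forall>z. (u has_derivative u' z) (at z)) \<and> (\<forall>b. (\<lambda>z. u' z b) \<in> radial_algebra X)"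
  using assms(2)
proof induction
  case (base \<phi>)
  then obtain \<phi>' where \<phi>': "\<phi>' \<in> X" "\<And>t. (\<phi> has_real_derivative \<phi>' t) (at t)"
    using assms(1) unfolding derivative_closed_def by blast
  have "((\<lambda>z. \<phi> (z \<bullet> z)) has_derivative (\<lambda>b. \<phi>' (z \<bullet> z) * (2 * (z \<bullet> b)))) (at z)" for z :: 'a
  proof -
    have 1: "((\<lambda>z. z \<bullet> z) has_derivative (\<lambda>b. 2 * (z \<bullet> b))) (at z)"
      by (auto intro!: derivative_eq_intros simp: inner_commute)
    have 2: "(\<phi> has_derivative (\<lambda>y. \<phi>' (z \<bullet> z) * y)) (at (z \<bullet> z))"
      using \<phi>'(2) by (simp add: has_field_derivative_def)
    show ?thesis
      using diff_chain_at[OF 1 2] by (simp add: o_def)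
  qed
  moreover have "(\<lambda>z::'a. \<phi>' (z \<bullet> z) * (2 * (z \<bullet> b))) \<in> radial_algebra X" for b
    by (intro radial_algebra.intros \<phi>')
  ultimately show ?case
    by (intro exI[of _ "\<lambda>z b. \<phi>' (z \<bullet> z) * (2 * (z \<bullet> b))"]) blast
next
  case (coord b)
  have "((\<lambda>z. z \<bullet> b) has_derivative (\<lambda>h. h \<bullet> b)) (at z)" for z :: 'a
    by (auto intro!: derivative_eq_intros)
  then show ?case
    by (intro exI[of _ "\<lambda>z h. h \<bullet> b"]) (auto intro: radial_algebra.const)
next
  case (const c)
  have "((\<lambda>z. c) has_derivative (\<lambda>h. 0)) (at z)" for z :: 'a
    by (auto intro!: derivative_eq_intros)
  then show ?case
    by (intro exI[of _ "\<lambda>z h. 0"]) (auto intro: radial_algebra.const)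
next
  case (add u v)
  then obtain u' v' where
    "\<And>z. (u has_derivative u' z) (at z)" "\<And>b. (\<lambda>z. u' z b) \<in> radial_algebra X"
    "\<And>z. (v has_derivative v' z) (at z)" "\<And>b. (\<lambda>z. v' z b) \<in> radial_algebra X"
    by blast
  then show ?case
    by (intro exI[of _ "\<lambda>z b. u' z b + v' z b"])
       (auto intro!: has_derivative_add radial_algebra.intros)
next
  case (mult u v)
  then obtain u' v' where *:
    "\<And>z. (u has_derivative u' z) (at z)" "\<And>b. (\<lambda>z. u' z b) \<in> radial_algebra X"
    "\<And>z. (v has_derivative v' z) (at z)" "\<And>b. (\<lambda>z. v' z b) \<in> radial_algebra X"
    by blast
  show ?case
    by (intro exI[of _ "\<lambda>z b. u z * v' z b + u' z b * v z"] conjI allI has_derivative_mult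
         radial_algebra.add radial_algebra.mult * mult.hyps)
qed

lemma radial_algebra_Ck:
  assumes "derivative_closed X" and "u \<in> radial_algebra X"
  shows "Ck k u"
  using assms(2)
proof (induction k arbitrary: u)
  case (0 u)
  then obtain u' where "\<And>z. (u has_derivative u' z) (at z)"
    using radial_algebra_derivative[OF assms(1)] by blast
  then show ?case
    by (auto intro!: continuous_at_imp_continuous_on has_derivative_continuous)
next
  case (Suc k u)
  then obtain u' where u': "\<And>z. (u has_derivative u' z) (at z)"
    "\<And>b. (\<lambda>z. u' z b) \<in> radial_algebra X"
    using radial_algebra_derivative[OF assms(1)] by blast
  have "frechet_derivative u (at z) = u' z" for z
    using frechet_derivative_at[OF u'(1)] by simp
  moreover have "u differentiable_on UNIV"
    using u'(1) by (auto simp: differentiable_on_def differentiable_def)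
  ultimately show ?case using Suc.IH[OF u'(2)] by simp
qed

text \<open>
  The source of all test functions used below: a compactly supported smooth profile in the
  variable \<open>(norm z)\<^sup>2\<close>.
\<close>
lemma test_function_radial:
  assumes "derivative_closed X" and "\<psi> \<in> X" and "\<And>t. T \<le> t \<Longrightarrow> \<psi> t = 0"
  shows "test_function (\<lambda>z::'a::euclidean_space. \<psi> ((norm z)\<^sup>2))"
  unfolding test_function_def
proof
  have "(\<lambda>z::'a. \<psi> (z \<bullet> z)) \<in> radial_algebra X"
    by (rule radial_algebra.base[OF assms(2)])
  then show "\<forall>k. Ck k (\<lambda>z::'a. \<psi> ((norm z)\<^sup>2))"
    using radial_algebra_Ck[OF assms(1)] by (auto simp: power2_norm_eq_inner)
  have "{z::'a. \<psi> ((norm z)\<^sup>2) \<noteq> 0} \<subseteq> cball 0 (sqrt \<bar>T\<bar>)"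
  proof
    fix z :: 'a assume "z \<in> {z. \<psi> ((norm z)\<^sup>2) \<noteq> 0}"
    then have "(norm z)\<^sup>2 < T" using assms(3)[of "(norm z)\<^sup>2"] by fastforce
    then have "norm z \<le> sqrt \<bar>T\<bar>" by (intro real_le_rsqrt) auto
    then show "z \<in> cball 0 (sqrt \<bar>T\<bar>)" by simp
  qed
  then show "compact (closure {z::'a. \<psi> ((norm z)\<^sup>2) \<noteq> 0})"
    using bounded_subset[OF bounded_cball] by (auto simp: compact_closure)
qed

section \<open>Smooth cutoffs\<close>
text \<open>
  The classical smooth function that vanishes to infinite order at \<open>0\<close>, with three parameters:
  the powers of \<open>t\<close> make the family closed under differentiation, \<open>\<eta>\<close> lets the
  cutoff tend to the indicator function of the positive half-line as \<open>\<eta>\<close> tends to \<open>0\<close>,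
  and \<open>(1 + t) powr \<beta>\<close>, after translation by \<open>1\<close>, produces the power weight of the
  extremal profile where it is cut off at \<open>1\<close>.
\<close>
definition flat :: "real \<Rightarrow> real \<Rightarrow> nat \<Rightarrow> real \<Rightarrow> real" where
  "flat \<eta> \<beta> n t = (if 0 < t then (1 + t) powr \<beta> * exp (- \<eta> / t) / t ^ n else 0)"

lemma tendsto_exp_neg_inverse_over_power:
  assumes "0 < \<eta>"
  shows "((\<lambda>t::real. exp (- \<eta> / t) / t ^ n) \<longlongrightarrow> 0) (at_right 0)"
proof -
  have "((\<lambda>y::real. y ^ n / exp y) \<longlongrightarrow> 0) at_top"
    by (rule tendsto_power_div_exp_0)
  moreover have "filterlim (\<lambda>t::real. \<eta> / t) at_top (at_right 0)"
    using filterlim_tendsto_pos_mult_at_top[OF tendsto_const assms filterlim_inverse_at_top_right]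
    by (simp add: divide_inverse)
  ultimately have "((\<lambda>t. (\<eta> / t) ^ n / exp (\<eta> / t)) \<longlongrightarrow> 0) (at_right 0)"
    by (rule filterlim_compose)
  from tendsto_mult_left[OF this, of "1 / \<eta> ^ n"] show ?thesis
    using assms by (simp add: power_divide exp_minus field_simps)
qed

lemma flat_has_derivative:
  assumes "0 < \<eta>"
  shows "(flat \<eta> \<beta> n has_real_derivative
    (\<beta> * flat \<eta> (\<beta> - 1) n t + \<eta> * flat \<eta> \<beta> (n + 2) t + (- real n) * flat \<eta> \<beta> (n + 1) t)) (at t)"
proof -
  consider "t < 0" | "t = 0" | "0 < t" by linarith
  then show ?thesis
  proof cases
    case 1
    have "((\<lambda>_. 0) has_real_derivative 0) (at t)" by simp
    then have "(flat \<eta> \<beta> n has_real_derivative 0) (at t)"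
      by (rule has_field_derivative_transform_within_open[of _ _ _ "{..<0}"])
         (use 1 in \<open>auto simp: flat_def\<close>)
    then show ?thesis using 1 by (simp add: flat_def)
  next
    case 2
    have "((\<lambda>t. (1 + t) powr \<beta> * (exp (- \<eta> / t) / t ^ (n + 1))) \<longlongrightarrow> (1 + 0) powr \<beta> * 0) (at_right 0)"
      by (intro tendsto_mult tendsto_exp_neg_inverse_over_power assms tendsto_intros) auto
    then have "((\<lambda>t. (1 + t) powr \<beta> * (exp (- \<eta> / t) / t ^ (n + 1))) \<longlongrightarrow> 0) (at_right 0)"
      by simp
    then have "((\<lambda>t. (flat \<eta> \<beta> n t - flat \<eta> \<beta> n 0) / (t - 0)) \<longlongrightarrow> 0) (at_right 0)"
      by (rule Lim_transform_eventually)
         (auto simp: flat_def eventually_at_filter)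
    moreover have "((\<lambda>t. (flat \<eta> \<beta> n t - flat \<eta> \<beta> n 0) / (t - 0)) \<longlongrightarrow> 0) (at_left 0)"
      by (rule Lim_transform_eventually[OF tendsto_const])
         (auto simp: flat_def eventually_at_filter)
    ultimately have "(flat \<eta> \<beta> n has_real_derivative 0) (at 0)"
      unfolding has_field_derivative_iff by (simp add: filterlim_split_at)
    then show ?thesis using 2 by (simp add: flat_def)
  next
    case 3
    have "((\<lambda>t. (1 + t) powr \<beta> * exp (- \<eta> / t) / t ^ n) has_real_derivative
        (\<beta> * ((1 + t) powr (\<beta> - 1) * exp (- \<eta> / t) / t ^ n)
         + \<eta> * ((1 + t) powr \<beta> * exp (- \<eta> / t) / t ^ (n + 2))
         + (- real n) * ((1 + t) powr \<beta> * exp (- \<eta> / t) / t ^ (n + 1)))) (at t)"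
    proof -
      have 1: "((\<lambda>t. (1 + t) powr \<beta>) has_real_derivative \<beta> * (1 + t) powr (\<beta> - 1)) (at t)"
        using 3 by (auto intro!: derivative_eq_intros)
      have 2: "((\<lambda>t. exp (- \<eta> / t)) has_real_derivative exp (- \<eta> / t) * (\<eta> / t ^ 2)) (at t)"
        using 3 by (auto intro!: derivative_eq_intros simp: power2_eq_square)
      have "((\<lambda>t. t powr (- real n)) has_real_derivative - real n * t powr (- real n - 1)) (at t)"
        using 3 by (auto intro!: derivative_eq_intros)
      then have "((\<lambda>t. 1 / t ^ n) has_real_derivative - real n * t powr (- real n - 1)) (at t)"
        by (rule has_field_derivative_transform_within_open[of _ _ _ "{0<..}"])
           (use 3 in \<open>auto simp: powr_minus_divide powr_realpow\<close>)
      moreover have "t powr (- real n - 1) = 1 / t ^ (n + 1)"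
        using 3 by (simp add: powr_diff powr_minus_divide powr_realpow)
      ultimately have 4: "((\<lambda>t. 1 / t ^ n) has_real_derivative - real n * (1 / t ^ (n + 1))) (at t)"
        by simp
      show ?thesis
        using DERIV_mult[OF DERIV_mult[OF 1 2] 4]
        by (rule DERIV_cong_ev[THEN iffD1, rotated -1])
           (auto simp: power_add power2_eq_square algebra_simps)
    qed
    then have "(flat \<eta> \<beta> n has_real_derivative
        (\<beta> * ((1 + t) powr (\<beta> - 1) * exp (- \<eta> / t) / t ^ n)
         + \<eta> * ((1 + t) powr \<beta> * exp (- \<eta> / t) / t ^ (n + 2))
         + (- real n) * ((1 + t) powr \<beta> * exp (- \<eta> / t) / t ^ (n + 1)))) (at t)"
      by (rule has_field_derivative_transform_within_open[of _ _ _ "{0<..}"])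
         (use 3 in \<open>auto simp: flat_def\<close>)
    then show ?thesis using 3 by (simp add: flat_def)
  qed
qed

inductive_set flat_algebra :: "(real \<Rightarrow> real) set" where
  flat: "0 < \<eta> \<Longrightarrow> (\<lambda>t. flat \<eta> \<beta> n (\<sigma> * t + \<tau>)) \<in> flat_algebra"
| const: "(\<lambda>t. c) \<in> flat_algebra"
| add: "\<phi> \<in> flat_algebra \<Longrightarrow> \<psi> \<in> flat_algebra \<Longrightarrow> (\<lambda>t. \<phi> t + \<psi> t) \<in> flat_algebra"
| mult: "\<phi> \<in> flat_algebra \<Longrightarrow> \<psi> \<in> flat_algebra \<Longrightarrow> (\<lambda>t. \<phi> t * \<psi> t) \<in> flat_algebra"

lemma flat_algebra_derivative_closed: "derivative_closed flat_algebra"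
  unfolding derivative_closed_def
proof
  fix \<phi> assume "\<phi> \<in> flat_algebra"
  then show "\<exists>\<phi>'\<in>flat_algebra. \<forall>t. (\<phi> has_real_derivative \<phi>' t) (at t)"
  proof induction
    case (flat \<eta> \<beta> n \<sigma> \<tau>)
    let ?d = "\<lambda>s. \<beta> * flat \<eta> (\<beta> - 1) n s + \<eta> * flat \<eta> \<beta> (n + 2) s + (- real n) * flat \<eta> \<beta> (n + 1) s"
    have "((\<lambda>t. flat \<eta> \<beta> n (\<sigma> * t + \<tau>)) has_real_derivative ?d (\<sigma> * t + \<tau>) * \<sigma>) (at t)" for t
      by (rule DERIV_chain2[OF flat_has_derivative[OF flat]]) (auto intro!: derivative_eq_intros)
    moreover have "(\<lambda>t. ?d (\<sigma> * t + \<tau>) * \<sigma>) \<in> flat_algebra"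
      by (intro flat_algebra.intros flat)
    ultimately show ?case
      by (intro bexI[of _ "\<lambda>t. ?d (\<sigma> * t + \<tau>) * \<sigma>"]) auto
  next
    case (const c)
    then show ?case by (intro bexI[of _ "\<lambda>t. 0"]) (auto intro: flat_algebra.const)
  next
    case (add \<phi> \<psi>)
    then obtain \<phi>' \<psi>' where *: "\<phi>' \<in> flat_algebra" "\<psi>' \<in> flat_algebra"
      "\<And>t. (\<phi> has_real_derivative \<phi>' t) (at t)" "\<And>t. (\<psi> has_real_derivative \<psi>' t) (at t)" by blast
    then show ?case
      by (intro bexI[of _ "\<lambda>t. \<phi>' t + \<psi>' t"]) (auto intro!: DERIV_add flat_algebra.add)
  next
    case (mult \<phi> \<psi>)
    then obtain \<phi>' \<psi>' where *: "\<phi>' \<in> flat_algebra" "\<psi>' \<in> flat_algebra"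
      "\<And>t. (\<phi> has_real_derivative \<phi>' t) (at t)" "\<And>t. (\<psi> has_real_derivative \<psi>' t) (at t)" by blast
    show ?case
      by (intro bexI[of _ "\<lambda>t. \<phi>' t * \<psi> t + \<psi>' t * \<phi> t"] allI DERIV_mult flat_algebra.add
          flat_algebra.mult * mult.hyps)
  qed
qed

lemma flat_algebra_sum:
  "(\<And>i. i \<in> I \<Longrightarrow> \<phi> i \<in> flat_algebra) \<Longrightarrow> (\<lambda>t. \<Sum>i\<in>I. \<phi> i t) \<in> flat_algebra"
  by (induction I rule: infinite_finite_induct) (auto intro: flat_algebra.intros)

lemma flat_algebra_continuous:
  assumes "\<phi> \<in> flat_algebra" shows "continuous_on A \<phi>"
proof -
  obtain \<phi>' where "\<And>t. (\<phi> has_real_derivative \<phi>' t) (at t)"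
    using assms flat_algebra_derivative_closed unfolding derivative_closed_def by blast
  then show ?thesis by (meson DERIV_isCont continuous_at_imp_continuous_on)
qed

lemma flat_algebra_antiderivative:
  assumes "\<phi> \<in> flat_algebra"
  shows "\<exists>\<psi>. (\<forall>t. (\<psi> has_real_derivative \<phi> t) (at t)) \<and> \<psi> T = 0"
proof -
  have "\<exists>F. \<forall>x. -\<infinity> < ereal x \<longrightarrow> ereal x < \<infinity> \<longrightarrow> (F has_vector_derivative \<phi> x) (at x)"
    using flat_algebra_continuous[OF assms, of UNIV]
    by (intro einterval_antiderivative) (auto simp: continuous_on_eq_continuous_at)
  then obtain F where "\<And>t. (F has_real_derivative \<phi> t) (at t)"
    by (auto simp: has_real_derivative_iff_has_vector_derivative)
  then have "((\<lambda>t. F t - F T) has_real_derivative \<phi> t) (at t)" for t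
    by (auto intro!: derivative_eq_intros)
  then show ?thesis by (intro exI[of _ "\<lambda>t. F t - F T"]) auto
qed

lemma derivative_closed_insert:
  assumes "derivative_closed X" and "\<phi> \<in> X" and "\<And>t. (\<psi> has_real_derivative \<phi> t) (at t)"
  shows "derivative_closed (insert \<psi> X)"
  using assms unfolding derivative_closed_def by blast

section \<open>Integral inequalities on an interval\<close>
text \<open>
  Young's inequality, applied to \<open>u\<close> and \<open>v\<close> after division by their norms. Adding
  \<open>e\<close> to the integrals before taking roots avoids a separate treatment of vanishing norms.
\<close>
lemma Holder_inequality_continuous:
  fixes u v :: "real \<Rightarrow> real"
  assumes u: "continuous_on {a..b} u" "\<And>x. x \<in> {a..b} \<Longrightarrow> 0 \<le> u x"
    and v: "continuous_on {a..b} v" "\<And>x. x \<in> {a..b} \<Longrightarrow> 0 \<le> v x"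
    and p: "1 < p" "1 < p'" "1 / p + 1 / p' = 1"
  shows "integral {a..b} (\<lambda>x. u x * v x) \<le>
    integral {a..b} (\<lambda>x. u x powr p) powr (1 / p) * integral {a..b} (\<lambda>x. v x powr p') powr (1 / p')"
proof -
  define U where "U = integral {a..b} (\<lambda>x. u x powr p)"
  define V where "V = integral {a..b} (\<lambda>x. v x powr p')"
  have [continuous_intros]: "continuous_on {a..b} (\<lambda>x. u x powr p)" "continuous_on {a..b} (\<lambda>x. v x powr p')"
    by (intro continuous_on_powr' u v continuous_intros; use u v p in force)+
  have nn: "0 \<le> U" "0 \<le> V"
    unfolding U_def V_def by (auto intro!: Henstock_Kurzweil_Integration.integral_nonneg integrable_continuous_real continuous_intros)
  have hasUV: "((\<lambda>x. u x powr p) has_integral U) {a..b}" "((\<lambda>x. v x powr p') has_integral V) {a..b}"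
    unfolding U_def V_def by (intro integrable_integral integrable_continuous_real continuous_intros)+
  have eps: "integral {a..b} (\<lambda>x. u x * v x) \<le> (U + e) powr (1 / p) * (V + e) powr (1 / p')"
    if e: "0 < e" for e
  proof -
    define A where "A = (U + e) powr (1 / p)"
    define B where "B = (V + e) powr (1 / p')"
    have AB: "0 < A" "0 < B" using nn e unfolding A_def B_def by auto
    have AB': "A powr p = U + e" "B powr p' = V + e"
      using nn e p unfolding A_def B_def by (auto simp: powr_powr)
    have "u x * v x \<le> A * B * (u x powr p / (U + e) / p + v x powr p' / (V + e) / p')"
      if x: "x \<in> {a..b}" for x
    proof -
      have "u x / A * (v x / B) \<le> (u x / A) powr p / p + (v x / B) powr p' / p'"
        using p AB u(2)[OF x] v(2)[OF x] by (intro Youngs_inequality) auto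
      also have "\<dots> = u x powr p / (U + e) / p + v x powr p' / (V + e) / p'"
        using AB u(2)[OF x] v(2)[OF x] by (simp add: powr_divide AB')
      finally show ?thesis using AB by (simp add: field_simps)
    qed
    then have "integral {a..b} (\<lambda>x. u x * v x) \<le>
        integral {a..b} (\<lambda>x. A * B * (u x powr p / (U + e) / p + v x powr p' / (V + e) / p'))"
      using nn e p
      by (intro integral_le integrable_continuous_real continuous_intros u v) auto
    also have "\<dots> = A * B * (U / (U + e) / p + V / (V + e) / p')"
      by (intro integral_unique has_integral_mult_right has_integral_add has_integral_divide hasUV)
    also have "\<dots> \<le> A * B * (1 / p + 1 / p')"
      using AB nn e p by (intro mult_left_mono add_mono divide_right_mono) auto
    finally show ?thesis using p unfolding A_def B_def by simp
  qed
  have "((\<lambda>e. (U + e) powr (1 / p) * (V + e) powr (1 / p')) \<longlongrightarrow>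
      (U + 0) powr (1 / p) * (V + 0) powr (1 / p')) (at_right 0)"
    using nn p by (intro tendsto_intros tendsto_powr2) (auto simp: eventually_at_filter)
  then have "integral {a..b} (\<lambda>x. u x * v x) \<le> (U + 0) powr (1 / p) * (V + 0) powr (1 / p')"
    by (rule tendsto_lowerbound) (auto simp: eventually_at_filter eps)
  then show ?thesis by (simp add: U_def V_def)
qed

lemma tail_integral_has_derivative:
  fixes \<psi> :: "real \<Rightarrow> real"
  assumes "continuous_on {x..R} \<psi>" and "\<rho> \<in> {x..R}"
  shows "((\<lambda>\<rho>. integral {\<rho>..R} \<psi>) has_real_derivative - \<psi> \<rho>) (at \<rho> within {x..R})"
proof -
  have "((\<lambda>\<rho>. integral {x..R} \<psi> - integral {x..\<rho>} \<psi>) has_real_derivative - \<psi> \<rho>) (at \<rho> within {x..R})"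
    using integral_has_real_derivative[OF assms] by (auto intro!: derivative_eq_intros)
  then show ?thesis
  proof (rule has_field_derivative_transform_within[of _ _ _ _ 1])
    fix y assume "y \<in> {x..R}"
    then show "integral {x..R} \<psi> - integral {x..y} \<psi> = integral {y..R} \<psi>"
      using Henstock_Kurzweil_Integration.integral_combine[of x y R \<psi>]
        integrable_continuous_real[OF assms(1)] by simp
  qed (use assms in auto)
qed

text \<open>
  Write \<open>G \<rho>\<close> for the inner integral and \<open>P \<rho>\<close> for the integral of \<open>\<psi>\<close> over
  \<open>{\<rho>..R}\<close>. Since \<open>s powr (-c)\<close> decreases, \<open>\<rho> powr c * G \<rho> \<le> P \<rho>\<close>. Hence
  the function
  \<open>E = (\<rho> powr (c*k) * G \<rho> powr k - P \<rho> powr k) / (c*k)\<close>, whose derivative is the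
  integrand on the left plus
  \<open>\<psi> / c * (P powr (k-1) - (\<rho> powr c * G) powr (k-1))\<close>, grows at least as fast as that
  integrand; it vanishes at \<open>R\<close> and is at least \<open>- P x powr k / (c*k)\<close> at \<open>x\<close>. This
  replaces Minkowski's integral inequality and gives the same constant.
\<close>
lemma weighted_Hardy_inequality:
  fixes \<psi> :: "real \<Rightarrow> real"
  assumes x: "0 < x" "x \<le> R" and c: "0 < c" and k: "1 \<le> k"
    and \<psi>: "continuous_on {x..R} \<psi>" "\<And>\<rho>. \<rho> \<in> {x..R} \<Longrightarrow> 0 \<le> \<psi> \<rho>"
  shows "integral {x..R} (\<lambda>\<rho>. \<rho> powr (c * k - 1) * integral {\<rho>..R} (\<lambda>s. s powr (- c) * \<psi> s) powr k)
    \<le> integral {x..R} \<psi> powr k / (c * k)"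
proof -
  define G where "G = (\<lambda>\<rho>. integral {\<rho>..R} (\<lambda>s. s powr (- c) * \<psi> s))"
  define P where "P = (\<lambda>\<rho>. integral {\<rho>..R} \<psi>)"
  have cont: "continuous_on {x..R} (\<lambda>s. s powr (- c) * \<psi> s)"
    using x by (intro continuous_intros \<psi>) auto
  have cont': "continuous_on {\<rho>..R} (\<lambda>s. s powr (- c) * \<psi> s)" "continuous_on {\<rho>..R} \<psi>"
    if "\<rho> \<in> {x..R}" for \<rho>
    using that by (auto intro: continuous_on_subset[OF cont] continuous_on_subset[OF \<psi>(1)])
  have dG: "(G has_real_derivative - (\<rho> powr (- c) * \<psi> \<rho>)) (at \<rho> within {x..R})"
    if "\<rho> \<in> {x..R}" for \<rho>
    unfolding G_def by (rule tail_integral_has_derivative[OF cont that])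
  have dP: "(P has_real_derivative - \<psi> \<rho>) (at \<rho> within {x..R})" if "\<rho> \<in> {x..R}" for \<rho>
    unfolding P_def by (rule tail_integral_has_derivative[OF \<psi>(1) that])
  have G0: "0 \<le> G \<rho>" if "\<rho> \<in> {x..R}" for \<rho>
    unfolding G_def using that cont' \<psi>(2)
    by (intro Henstock_Kurzweil_Integration.integral_nonneg integrable_continuous_real) auto
  have P0: "0 \<le> P \<rho>" if "\<rho> \<in> {x..R}" for \<rho>
    unfolding P_def using that cont' \<psi>(2)
    by (intro Henstock_Kurzweil_Integration.integral_nonneg integrable_continuous_real) auto
  have GP: "G \<rho> \<le> \<rho> powr (- c) * P \<rho>" if \<rho>: "\<rho> \<in> {x..R}" for \<rho>
  proof -
    have "G \<rho> \<le> integral {\<rho>..R} (\<lambda>s. \<rho> powr (- c) * \<psi> s)"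
      unfolding G_def using \<rho> x c \<psi>(2) cont'[OF \<rho>]
      by (intro integral_le integrable_continuous_real continuous_intros mult_right_mono powr_mono2') auto
    then show ?thesis unfolding P_def by simp
  qed
  have cG: "continuous_on {x..R} G" using dG by (meson DERIV_continuous continuous_on_eq_continuous_within)
  have ck: "0 < c * k" using c k by simp
  have eps: "integral {x..R} (\<lambda>\<rho>. \<rho> powr (c * k - 1) * G \<rho> powr k) \<le> (e * R powr c + P x) powr k / (c * k)"
    if e: "0 < e" for e
  proof -
    \<comment> \<open>The shifts by \<open>e\<close> keep the bases away from \<open>0\<close>, where \<open>powr\<close> is not differentiable, and
      preserve \<open>\<rho> powr c * g \<rho> \<le> \<pi> \<rho>\<close> because \<open>\<rho> \<le> R\<close>.\<close>
    define g where "g = (\<lambda>\<rho>. e + G \<rho>)"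
    define \<pi> where "\<pi> = (\<lambda>\<rho>. e * R powr c + P \<rho>)"
    define E where "E = (\<lambda>\<rho>. (\<rho> powr (c * k) * g \<rho> powr k - \<pi> \<rho> powr k) / (c * k))"
    define E' where "E' = (\<lambda>\<rho>. \<rho> powr (c * k - 1) * g \<rho> powr k
       + \<psi> \<rho> / c * (\<pi> \<rho> powr (k - 1) - (\<rho> powr c * g \<rho>) powr (k - 1)))"
    have pos: "0 < g \<rho>" "0 < \<pi> \<rho>" "0 < \<rho>" if "\<rho> \<in> {x..R}" for \<rho>
      using G0[OF that] P0[OF that] e x that unfolding g_def \<pi>_def
      by (auto intro!: add_pos_nonneg)
    have dE: "(E has_real_derivative E' \<rho>) (at \<rho> within {x..R})" if \<rho>: "\<rho> \<in> {x..R}" for \<rho>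
    proof -
      have dg: "(g has_real_derivative - (\<rho> powr (- c) * \<psi> \<rho>)) (at \<rho> within {x..R})"
        unfolding g_def using dG[OF \<rho>] by (auto intro!: derivative_eq_intros)
      have d\<pi>: "(\<pi> has_real_derivative - \<psi> \<rho>) (at \<rho> within {x..R})"
        unfolding \<pi>_def using dP[OF \<rho>] by (auto intro!: derivative_eq_intros)
      have "((\<lambda>\<rho>. \<rho> powr (c * k)) has_real_derivative c * k * \<rho> powr (c * k - 1)) (at \<rho> within {x..R})"
        using pos[OF \<rho>] by (auto intro!: derivative_eq_intros)
      from DERIV_mult[OF this DERIV_chain2[OF has_real_derivative_powr dg]]
      have "((\<lambda>\<rho>. \<rho> powr (c * k) * g \<rho> powr k) has_real_derivative
         c * k * \<rho> powr (c * k - 1) * g \<rho> powr k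
         + k * g \<rho> powr (k - 1) * (- (\<rho> powr (- c) * \<psi> \<rho>)) * \<rho> powr (c * k)) (at \<rho> within {x..R})"
        using pos[OF \<rho>] by simp
      from DERIV_cdivide[OF DERIV_diff[OF this DERIV_chain2[OF has_real_derivative_powr d\<pi>]], of k "c * k"]
      have "(E has_real_derivative (c * k * \<rho> powr (c * k - 1) * g \<rho> powr k
         + k * g \<rho> powr (k - 1) * (- (\<rho> powr (- c) * \<psi> \<rho>)) * \<rho> powr (c * k)
         - k * \<pi> \<rho> powr (k - 1) * (- \<psi> \<rho>)) / (c * k)) (at \<rho> within {x..R})"
        using pos[OF \<rho>] unfolding E_def by simp
      also have "(c * k * \<rho> powr (c * k - 1) * g \<rho> powr k
         + k * g \<rho> powr (k - 1) * (- (\<rho> powr (- c) * \<psi> \<rho>)) * \<rho> powr (c * k)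
         - k * \<pi> \<rho> powr (k - 1) * (- \<psi> \<rho>)) / (c * k) = \<rho> powr (c * k - 1) * g \<rho> powr k
         + \<psi> \<rho> / c * (\<pi> \<rho> powr (k - 1) - g \<rho> powr (k - 1) * (\<rho> powr (- c) * \<rho> powr (c * k)))"
        using c k by (simp add: field_simps)
      also have "\<rho> powr (- c) * \<rho> powr (c * k) = (\<rho> powr c) powr (k - 1)"
        by (simp add: powr_powr flip: powr_add) (simp add: algebra_simps)
      also have "\<rho> powr (c * k - 1) * g \<rho> powr k
         + \<psi> \<rho> / c * (\<pi> \<rho> powr (k - 1) - g \<rho> powr (k - 1) * (\<rho> powr c) powr (k - 1)) = E' \<rho>"
        using pos[OF \<rho>] unfolding E'_def by (simp add: powr_mult mult.commute)
      finally show ?thesis .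
    qed
    have "(E' has_integral E R - E x) {x..R}"
      using dE x by (intro fundamental_theorem_of_calculus)
        (auto simp: has_real_derivative_iff_has_vector_derivative)
    moreover have "((\<lambda>\<rho>. \<rho> powr (c * k - 1) * G \<rho> powr k) has_integral
        integral {x..R} (\<lambda>\<rho>. \<rho> powr (c * k - 1) * G \<rho> powr k)) {x..R}"
      using x G0 k cG by (intro integrable_integral integrable_continuous_real continuous_intros
           continuous_on_powr') auto
    moreover have "\<rho> powr (c * k - 1) * G \<rho> powr k \<le> E' \<rho>" if \<rho>: "\<rho> \<in> {x..R}" for \<rho>
    proof -
      have "\<rho> powr c * g \<rho> \<le> R powr c * e + \<rho> powr c * (\<rho> powr (- c) * P \<rho>)"
        unfolding g_def distrib_left using e \<rho> x c
        by (intro add_mono mult_right_mono mult_left_mono GP powr_mono2) auto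
      also have "\<dots> = \<pi> \<rho>"
        using \<rho> x by (simp add: \<pi>_def powr_minus)
      finally have "(\<rho> powr c * g \<rho>) powr (k - 1) \<le> \<pi> \<rho> powr (k - 1)"
        using k pos[OF \<rho>] by (intro powr_mono2) auto
      then have "0 \<le> \<psi> \<rho> / c * (\<pi> \<rho> powr (k - 1) - (\<rho> powr c * g \<rho>) powr (k - 1))"
        using \<psi>(2)[OF \<rho>] c by simp
      moreover have "\<rho> powr (c * k - 1) * G \<rho> powr k \<le> \<rho> powr (c * k - 1) * g \<rho> powr k"
        using G0[OF \<rho>] e k unfolding g_def by (intro mult_left_mono powr_mono2) auto
      ultimately show ?thesis unfolding E'_def by linarith
    qed
    ultimately have "integral {x..R} (\<lambda>\<rho>. \<rho> powr (c * k - 1) * G \<rho> powr k) \<le> E R - E x"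
      by (meson has_integral_le)
    also have "E R = 0"
      using x e by (simp add: E_def g_def \<pi>_def G_def P_def powr_mult powr_powr mult.commute)
    also have "0 - E x \<le> \<pi> x powr k / (c * k)"
      unfolding E_def using c k by (simp add: field_simps)
    finally show ?thesis unfolding \<pi>_def .
  qed
  have "((\<lambda>e. (e * R powr c + P x) powr k / (c * k)) \<longlongrightarrow> (0 * R powr c + P x) powr k / (c * k)) (at_right 0)"
    using P0[of x] x k ck
    by (intro tendsto_divide tendsto_powr2 tendsto_intros) (auto simp: eventually_at_filter)
  then have "integral {x..R} (\<lambda>\<rho>. \<rho> powr (c * k - 1) * G \<rho> powr k) \<le> (0 * R powr c + P x) powr k / (c * k)"
    by (rule tendsto_lowerbound) (auto simp: eventually_at_filter eps)
  then show ?thesis by (simp add: G_def P_def)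
qed

section \<open>Radial profiles and their weighted integrals\<close>
text \<open>
  Restricting the radial function to a line through the origin gives the even \<open>C\<^sup>1\<close>
  extension \<open>h\<close> of the profile. It is regular at \<open>0\<close>, which the profile itself need not
  be, and carries the same derivative on the positive half-line.
\<close>
lemma test_function_profile:
  fixes f :: "real \<Rightarrow> real"
  assumes "test_function (\<lambda>z :: 'a::euclidean_space. f (norm z))"
  obtains h h' R where "0 < R" "\<And>t. (h has_real_derivative h' t) (at t)" "continuous_on UNIV h'"
    "\<And>t. R \<le> t \<Longrightarrow> h t = 0" "\<And>t. R \<le> t \<Longrightarrow> h' t = 0"
    "\<And>t. 0 < t \<Longrightarrow> f t = h t" "\<And>t. 0 < t \<Longrightarrow> deriv f t = h' t"
proof -
  define u where "u = (\<lambda>z :: 'a. f (norm z))"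
  define e :: 'a where "e = (SOME b. b \<in> Basis)"
  have e: "e \<in> Basis" unfolding e_def by (simp add: some_in_eq)
  define h where "h = (\<lambda>t. u (t *\<^sub>R e))"
  define h' where "h' = (\<lambda>t. frechet_derivative u (at (t *\<^sub>R e)) e)"
  have "Ck 1 u" and cpt: "compact (closure {z. u z \<noteq> 0})"
    using assms unfolding test_function_def u_def by blast+
  then have diff: "u differentiable_on UNIV"
    and cont: "continuous_on UNIV (\<lambda>z. frechet_derivative u (at z) e)"
    using e by auto
  have du: "(u has_derivative frechet_derivative u (at z)) (at z)" for z
    using diff by (simp add: differentiable_on_def frechet_derivative_works)
  have dh: "(h has_real_derivative h' t) (at t)" for t
  proof -
    have 1: "((\<lambda>t. t *\<^sub>R e) has_derivative (\<lambda>s. s *\<^sub>R e)) (at t)"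
      by (auto intro!: derivative_eq_intros)
    have "linear (frechet_derivative u (at (t *\<^sub>R e)))"
      using du by (rule has_derivative_linear)
    then have "frechet_derivative u (at (t *\<^sub>R e)) (s *\<^sub>R e) = h' t * s" for s
      by (simp add: linear_scale h'_def)
    then show ?thesis
      using diff_chain_at[OF 1 du] by (simp add: has_field_derivative_def o_def h_def)
  qed
  have ch': "continuous_on UNIV h'"
    unfolding h'_def by (rule continuous_on_compose2[OF cont]) (auto intro!: continuous_intros)
  obtain r where r: "\<And>z. u z \<noteq> 0 \<Longrightarrow> norm z \<le> r"
    using compact_imp_bounded[OF cpt] closure_subset[of "{z. u z \<noteq> 0}"] unfolding bounded_iff by blast
  have h0: "h t = 0" if "\<bar>r\<bar> < t" for t
    using r[of "t *\<^sub>R e"] e that unfolding h_def by fastforce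
  have h'0: "h' t = 0" if "\<bar>r\<bar> < t" for t
  proof -
    have "((\<lambda>_. 0) has_real_derivative 0) (at t)" by simp
    then have "(h has_real_derivative 0) (at t)"
      by (rule has_field_derivative_transform_within_open[of _ _ _ "{\<bar>r\<bar><..}"]) (use h0 that in auto)
    then show ?thesis using dh DERIV_unique by blast
  qed
  have fh: "f t = h t" if "0 < t" for t
    using that e by (simp add: h_def u_def)
  have "deriv f t = h' t" if "0 < t" for t
    using has_field_derivative_transform_within_open[OF dh, of "{0<..}" t f] that fh
    by (auto intro: DERIV_imp_deriv)
  with dh ch' h0 h'0 fh show ?thesis
    by (intro that[of "\<bar>r\<bar> + 1" h h']) auto
qed

text \<open>
  Turns the Lebesgue integrals over the half-line into gauge integrals over a compact interval,
  and shows that they converge.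
\<close>
lemma weighted_integral_half_line:
  fixes f h :: "real \<Rightarrow> real"
  assumes h: "continuous_on {0..R} h" "\<And>t. R \<le> t \<Longrightarrow> h t = 0" "\<And>t. 0 < t \<Longrightarrow> f t = h t"
    and a: "0 \<le> a" and s: "0 < s"
  shows "set_integrable lborel {0<..} (\<lambda>\<rho>. \<rho> powr a * \<bar>f \<rho>\<bar> powr s)" (is ?A)
    and "(LBINT \<rho>:{0<..}. \<rho> powr a * \<bar>f \<rho>\<bar> powr s) = integral {0..R} (\<lambda>\<rho>. \<rho> powr a * \<bar>h \<rho>\<bar> powr s)" (is ?B)
    and "(\<lambda>\<rho>. \<rho> powr a * \<bar>h \<rho>\<bar> powr s) integrable_on {0..R}" (is ?C)
proof -
  let ?F = "\<lambda>\<rho>. \<rho> powr a * \<bar>f \<rho>\<bar> powr s" and ?H = "\<lambda>\<rho>. \<rho> powr a * \<bar>h \<rho>\<bar> powr s"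
  \<comment> \<open>For \<open>a = 0\<close> the weight \<open>\<rho> powr a\<close> jumps at \<open>0\<close>; the modification removes this
    discontinuity and does not affect the integral.\<close>
  define K where "K = (\<lambda>\<rho>. (if a = 0 then 1 else \<rho> powr a) * \<bar>h \<rho>\<bar> powr s)"
  have "continuous_on {0..R} (\<lambda>\<rho>. if a = 0 then 1 else \<rho> powr a)"
  proof (cases "a = 0")
    case False
    then show ?thesis using a by (auto intro!: continuous_on_powr' continuous_on_id continuous_on_const)
  qed simp
  moreover have "continuous_on {0..R} (\<lambda>\<rho>. \<bar>h \<rho>\<bar> powr s)"
    by (intro continuous_on_powr' continuous_intros h) (use s in auto)
  ultimately have "continuous_on {0..R} K"
    unfolding K_def by (rule continuous_on_mult)
  then have "set_integrable lborel {0..R} K" by (rule borel_integrable_atLeastAtMost')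
  then have "set_integrable lborel {0<..R} K" by (rule set_integrable_subset) auto
  then have iF: "set_integrable lborel {0<..R} ?F"
    by (subst set_integrable_cong[where f' = K, OF refl refl]) (auto simp: K_def h)
  have eq: "(\<lambda>\<rho>. indicator {0<..} \<rho> *\<^sub>R ?F \<rho>) = (\<lambda>\<rho>. indicator {0<..R} \<rho> *\<^sub>R ?F \<rho>)"
    using s h(2,3) by (auto simp: indicator_def fun_eq_iff)
  show ?A using iF unfolding set_integrable_def eq .
  have neg: "negligible (sym_diff {0<..R} {0..R})"
    by (rule negligible_subset[of "{0}"]) auto
  have FH: "(?F has_integral I) {0<..R} \<longleftrightarrow> (?H has_integral I) {0..R}" for I
  proof -
    have "(?F has_integral I) {0<..R} \<longleftrightarrow> (?H has_integral I) {0<..R}"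
      by (rule has_integral_cong) (auto simp: h)
    also have "\<dots> \<longleftrightarrow> (?H has_integral I) {0..R}"
      by (rule has_integral_spike_set_eq) (rule negligible_subset[of "{0}"]; auto)+
    finally show ?thesis .
  qed
  have "?F integrable_on {0<..R}" "(LBINT \<rho>:{0<..R}. ?F \<rho>) = integral {0<..R} ?F"
    using set_borel_integral_eq_integral[OF iF] by auto
  then have "(?F has_integral (LBINT \<rho>:{0<..R}. ?F \<rho>)) {0<..R}"
    by (simp add: has_integral_iff)
  then have H: "(?H has_integral (LBINT \<rho>:{0<..R}. ?F \<rho>)) {0..R}"
    by (rule FH[THEN iffD1])
  then show ?C by (auto simp: integrable_on_def)
  have "(LBINT \<rho>:{0<..}. ?F \<rho>) = (LBINT \<rho>:{0<..R}. ?F \<rho>)"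
    unfolding set_lebesgue_integral_def eq ..
  then show ?B using H by (simp add: integral_unique)
qed

section \<open>The upper bound\<close>
lemma integral_le_from_tails:
  fixes F :: "real \<Rightarrow> real"
  assumes "F integrable_on {0..R}" "0 < R" and "\<And>x. 0 < x \<Longrightarrow> x \<le> R \<Longrightarrow> integral {x..R} F \<le> K"
  shows "integral {0..R} F \<le> K"
proof -
  have "continuous_on {0..R} (\<lambda>x. integral {x..R} F)"
    by (rule indefinite_integral_continuous_1'[OF assms(1)])
  then have "((\<lambda>x. integral {x..R} F) \<longlongrightarrow> integral {0..R} F) (at 0 within {0..R})"
    using assms(2) by (auto simp: continuous_on_def)
  moreover have "at 0 within {0..R} = at_right 0"
    using assms(2) by (simp add: at_within_Icc_at_right)
  ultimately have "((\<lambda>x. integral {x..R} F) \<longlongrightarrow> integral {0..R} F) (at_right 0)" by simp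
  moreover have "\<forall>\<^sub>F x in at_right 0. integral {x..R} F \<le> K"
    using eventually_at_right_real[OF assms(2)] by eventually_elim (use assms(3) in auto)
  ultimately show ?thesis
    by (rule tendsto_upperbound) simp
qed

lemma abs_le_integral_derivative:
  fixes h :: "real \<Rightarrow> real"
  assumes "\<And>t. (h has_real_derivative h' t) (at t)" "continuous_on UNIV h'" "h R = 0" "\<rho> \<le> R"
  shows "\<bar>h \<rho>\<bar> \<le> integral {\<rho>..R} (\<lambda>s. \<bar>h' s\<bar>)"
proof -
  have c: "continuous_on {\<rho>..R} h'" using assms(2) by (rule continuous_on_subset) auto
  have "(h' has_integral h R - h \<rho>) {\<rho>..R}"
    using assms(4) by (intro fundamental_theorem_of_calculus)
      (auto intro!: DERIV_subset[OF assms(1)] simp flip: has_real_derivative_iff_has_vector_derivative)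
  then have "\<bar>h \<rho>\<bar> = \<bar>integral {\<rho>..R} h'\<bar>" using assms(3) by (simp add: integral_unique)
  also have "\<dots> \<le> integral {\<rho>..R} (\<lambda>s. \<bar>h' s\<bar>)"
    using c integral_norm_bound_integral[of h' "{\<rho>..R}" "\<lambda>s. \<bar>h' s\<bar>"]
    by (auto intro!: integrable_continuous_real continuous_intros)
  finally show ?thesis .
qed

lemma integral_powr_le:
  fixes m :: real
  assumes "0 < m" "0 < \<rho>" "\<rho> \<le> R"
  shows "integral {\<rho>..R} (\<lambda>s. s powr (- m - 1)) \<le> \<rho> powr (- m) / m"
proof -
  have "((\<lambda>s. s powr (- m - 1)) has_integral (- (R powr (- m)) / m) - (- (\<rho> powr (- m)) / m)) {\<rho>..R}"
    using assms by (intro fundamental_theorem_of_calculus)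
      (auto intro!: derivative_eq_intros simp flip: has_real_derivative_iff_has_vector_derivative)
  then show ?thesis using assms by (simp add: integral_unique field_simps)
qed

text \<open>
  Starting from the bound of \<open>\<bar>h \<rho>\<bar>\<close> by the integral of \<open>\<bar>h'\<bar>\<close> over \<open>{\<rho>..R}\<close>, Hoelder's inequality
  with the auxiliary weight \<open>s powr (- (D - p) / q)\<close> bounds \<open>\<bar>h \<rho>\<bar> powr q\<close> by a
  power of \<open>\<rho>\<close> times the \<open>q/p\<close>-th power of the weighted tail integral \<open>G\<close>.
  The relation between \<open>p\<close> and \<open>q\<close> makes the total power of \<open>\<rho>\<close> exactly
  the one for which the weighted Hardy inequality, with exponent \<open>k = q / p\<close>, applies to
  \<open>G\<close>.
\<close>
lemma radial_Sobolev_bound: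
  fixes h h' :: "real \<Rightarrow> real"
  assumes h: "\<And>t. (h has_real_derivative h' t) (at t)" "continuous_on UNIV h'" "h R = 0"
    and R: "0 < R" and p: "1 < p" "p < D" and q: "p \<le> q" "q = p * Dr / (D - p)"
    and int: "(\<lambda>\<rho>. \<rho> powr (Dr - 1) * \<bar>h \<rho>\<bar> powr q) integrable_on {0..R}"
      "(\<lambda>\<rho>. \<rho> powr (D - 1) * \<bar>h' \<rho>\<bar> powr p) integrable_on {0..R}"
  shows "integral {0..R} (\<lambda>\<rho>. \<rho> powr (Dr - 1) * \<bar>h \<rho>\<bar> powr q)
    \<le> (q / (q - 1) * ((p - 1) / (D - p))) powr (q * (1 - 1 / p)) * (p / (D - p)) *
       integral {0..R} (\<lambda>\<rho>. \<rho> powr (D - 1) * \<bar>h' \<rho>\<bar> powr p) powr (q / p)"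
proof (rule integral_le_from_tails[OF int(1) R])
  fix x assume x: "0 < x" "x \<le> R"
  \<comment> \<open>Any exponent strictly between \<open>0\<close> and \<open>D - p\<close> would serve; this one yields the
    factor \<open>Q\<close>.\<close>
  define c where "c = (D - p) / q"
  define m where "m = (D - p) / (p - 1) * (1 - 1 / q)"
  define p' where "p' = p / (p - 1)"
  define \<psi> where "\<psi> = (\<lambda>\<rho>. \<rho> powr (D - 1) * \<bar>h' \<rho>\<bar> powr p)"
  define G where "G = (\<lambda>\<rho>. integral {\<rho>..R} (\<lambda>s. s powr (- c) * \<psi> s))"
  have q1: "1 < q" using p q by linarith
  have c0: "0 < c" and m0: "0 < m" using p q1 by (auto simp: c_def m_def)
  have m: "m = (D - p - c) / (p - 1)"
    by (simp add: m_def c_def right_diff_distrib diff_divide_distrib mult.commute)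
  have p': "1 < p'" "1 / p + 1 / p' = 1" "1 / p' = 1 - 1 / p"
    using p by (auto simp: p'_def field_simps)
  have Dr: "Dr = q * (D - p) / p" using p q(2) by (simp add: field_simps)
  have ch': "continuous_on A h'" for A using h(2) by (rule continuous_on_subset) auto
  have c\<psi>: "continuous_on {\<rho>..R} \<psi>" if "0 < \<rho>" for \<rho>
    unfolding \<psi>_def using that p by (intro continuous_intros continuous_on_powr' ch') auto
  have pw: "\<bar>h \<rho>\<bar> \<le> G \<rho> powr (1 / p) * (\<rho> powr (- m) / m) powr (1 / p')" if \<rho>: "0 < \<rho>" "\<rho> \<le> R" for \<rho>
  proof -
    define b where "b = (D - 1 - c) / p"
    have "\<bar>h \<rho>\<bar> \<le> integral {\<rho>..R} (\<lambda>s. \<bar>h' s\<bar>)"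
      by (rule abs_le_integral_derivative[OF h \<rho>(2)])
    also have "\<dots> = integral {\<rho>..R} (\<lambda>s. (s powr b * \<bar>h' s\<bar>) * s powr (- b))"
      using \<rho> by (intro integral_cong) (auto simp: powr_minus)
    also have "\<dots> \<le> integral {\<rho>..R} (\<lambda>s. (s powr b * \<bar>h' s\<bar>) powr p) powr (1 / p)
        * integral {\<rho>..R} (\<lambda>s. (s powr (- b)) powr p') powr (1 / p')"
      using \<rho> by (intro Holder_inequality_continuous p p' continuous_intros ch') auto
    also have "integral {\<rho>..R} (\<lambda>s. (s powr b * \<bar>h' s\<bar>) powr p) = G \<rho>"
      unfolding G_def
    proof (rule integral_cong)
      fix s assume "s \<in> {\<rho>..R}"
      then have "0 < s" using \<rho> by auto
      have "b * p = (- c) + (D - 1)" using p by (simp add: b_def)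
      then have "s powr (b * p) = s powr (- c) * s powr (D - 1)" by (simp only: powr_add)
      then show "(s powr b * \<bar>h' s\<bar>) powr p = s powr (- c) * \<psi> s"
        by (simp add: powr_mult powr_powr \<psi>_def)
    qed
    also have "integral {\<rho>..R} (\<lambda>s. (s powr (- b)) powr p') = integral {\<rho>..R} (\<lambda>s. s powr (- m - 1))"
    proof -
      have "b * p' = m + 1"
        using p unfolding m by (simp add: b_def p'_def field_simps)
      then have "- b * p' = - m - 1" by simp
      then show ?thesis by (simp add: powr_powr)
    qed
    also have "G \<rho> powr (1 / p) * integral {\<rho>..R} (\<lambda>s. s powr (- m - 1)) powr (1 / p')
        \<le> G \<rho> powr (1 / p) * (\<rho> powr (- m) / m) powr (1 / p')"
      using m0 \<rho> p'(1)
      by (intro mult_left_mono powr_mono2 integral_powr_le Henstock_Kurzweil_Integration.integral_nonneg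
            integrable_continuous_real continuous_intros) auto
    finally show ?thesis .
  qed
  have \<psi>_tail: "0 \<le> integral {x..R} \<psi>" "integral {x..R} \<psi> \<le> integral {0..R} \<psi>"
    using x int(2) integrable_continuous_real[OF c\<psi>[OF x(1)]] unfolding \<psi>_def
    by (auto intro!: integral_subset_le Henstock_Kurzweil_Integration.integral_nonneg)
  define L where "L = (1 / m) powr (q * (1 - 1 / p))"
  have pw': "\<rho> powr (Dr - 1) * \<bar>h \<rho>\<bar> powr q \<le> L * (\<rho> powr (c * (q / p) - 1) * G \<rho> powr (q / p))"
    if \<rho>: "\<rho> \<in> {x..R}" for \<rho>
  proof -
    have \<rho>0: "0 < \<rho>" "\<rho> \<le> R" using \<rho> x by auto
    have G0: "0 \<le> G \<rho>" unfolding G_def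
      using c\<psi>[of \<rho>] \<rho>0
      by (intro Henstock_Kurzweil_Integration.integral_nonneg integrable_continuous_real continuous_intros)
         (auto simp: \<psi>_def)
    have "\<bar>h \<rho>\<bar> powr q \<le> (G \<rho> powr (1 / p) * (\<rho> powr (- m) / m) powr (1 / p')) powr q"
      using pw[OF \<rho>0] q1 by (intro powr_mono2) auto
    also have "\<dots> = G \<rho> powr (q / p) * (\<rho> powr (- m) * (1 / m)) powr (q * (1 - 1 / p))"
      using G0 m0 by (simp add: powr_mult powr_powr p'(3) mult.commute)
    also have "\<dots> = G \<rho> powr (q / p) * (\<rho> powr (- m * (q * (1 - 1 / p))) * L)"
      using m0 by (simp only: powr_mult powr_powr L_def)
    finally have "\<rho> powr (Dr - 1) * \<bar>h \<rho>\<bar> powr q \<le>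
        \<rho> powr (Dr - 1) * (G \<rho> powr (q / p) * (\<rho> powr (- m * (q * (1 - 1 / p))) * L))"
      by (intro mult_left_mono) auto
    also have "\<dots> = L * ((\<rho> powr (Dr - 1) * \<rho> powr (- m * (q * (1 - 1 / p)))) * G \<rho> powr (q / p))"
      by simp
    also have "\<rho> powr (Dr - 1) * \<rho> powr (- m * (q * (1 - 1 / p))) = \<rho> powr (c * (q / p) - 1)"
    proof -
      have "m * (1 - 1 / p) = (D - p - c) / p"
        using p unfolding m by (simp add: field_simps)
      then have "m * (q * (1 - 1 / p)) = q * ((D - p - c) / p)"
        by (metis mult.assoc mult.commute)
      then have "Dr - 1 + - m * (q * (1 - 1 / p)) = c * (q / p) - 1"
        using p unfolding Dr by (simp add: right_diff_distrib diff_divide_distrib mult.commute)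
      then show ?thesis by (simp only: powr_add[symmetric])
    qed
    finally show ?thesis .
  qed
  have cG: "continuous_on {x..R} G"
    unfolding G_def using x c\<psi>[of x]
    by (intro indefinite_integral_continuous_1' integrable_continuous_real continuous_intros) auto
  have G0: "0 \<le> G \<rho>" if "\<rho> \<in> {x..R}" for \<rho>
    unfolding G_def using that x c\<psi>[of \<rho>]
    by (intro Henstock_Kurzweil_Integration.integral_nonneg integrable_continuous_real continuous_intros)
       (auto simp: \<psi>_def)
  have "integral {x..R} (\<lambda>\<rho>. \<rho> powr (Dr - 1) * \<bar>h \<rho>\<bar> powr q)
      \<le> integral {x..R} (\<lambda>\<rho>. L * (\<rho> powr (c * (q / p) - 1) * G \<rho> powr (q / p)))"
  proof (rule integral_le[OF _ _ pw'])
    show "(\<lambda>\<rho>. \<rho> powr (Dr - 1) * \<bar>h \<rho>\<bar> powr q) integrable_on {x..R}"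
      by (rule integrable_subinterval_real[OF int(1)]) (use x in auto)
    show "(\<lambda>\<rho>. L * (\<rho> powr (c * (q / p) - 1) * G \<rho> powr (q / p))) integrable_on {x..R}"
      by (intro integrable_continuous_real continuous_intros continuous_on_powr' cG)
         (use x p q1 G0 in auto)
  qed
  also have "\<dots> = L * integral {x..R} (\<lambda>\<rho>. \<rho> powr (c * (q / p) - 1) * G \<rho> powr (q / p))"
    by simp
  also have "\<dots> \<le> L * (integral {x..R} \<psi> powr (q / p) / (c * (q / p)))"
    unfolding G_def using x c0 p q(1) q1 c\<psi>[of x]
    by (intro mult_left_mono weighted_Hardy_inequality) (auto simp: L_def \<psi>_def)
  also have "\<dots> \<le> L * (integral {0..R} \<psi> powr (q / p) / (c * (q / p)))"
    using c0 p q1 \<psi>_tail by (intro mult_left_mono divide_right_mono powr_mono2) (auto simp: L_def)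
  also have "\<dots> = L * (p / (D - p)) * integral {0..R} \<psi> powr (q / p)"
    using p q1 by (simp add: c_def)
  also have "1 / m = q / (q - 1) * ((p - 1) / (D - p))"
    using p q1 by (simp add: m_def field_simps)
  then have "L = (q / (q - 1) * ((p - 1) / (D - p))) powr (q * (1 - 1 / p))"
    by (simp add: L_def)
  finally show "integral {x..R} (\<lambda>\<rho>. \<rho> powr (Dr - 1) * \<bar>h \<rho>\<bar> powr q)
    \<le> (q / (q - 1) * ((p - 1) / (D - p))) powr (q * (1 - 1 / p)) * (p / (D - p)) *
       integral {0..R} (\<lambda>\<rho>. \<rho> powr (D - 1) * \<bar>h' \<rho>\<bar> powr p) powr (q / p)"
    unfolding \<psi>_def .
qed

text \<open>
  For \<open>p = 1\<close> the weighted Hardy inequality applies directly, with \<open>k = q\<close> and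
  \<open>\<psi> = \<rho> powr (D - 1) * \<bar>h'\<bar>\<close>, and gives the sharp constant.
\<close>
lemma radial_Sobolev_bound_L1:
  fixes h h' :: "real \<Rightarrow> real"
  assumes h: "\<And>t. (h has_real_derivative h' t) (at t)" "continuous_on UNIV h'" "h R = 0"
    and R: "0 < R" and D: "1 < D" and q: "1 \<le> q" "q = Dr / (D - 1)"
    and int: "(\<lambda>\<rho>. \<rho> powr (Dr - 1) * \<bar>h \<rho>\<bar> powr q) integrable_on {0..R}"
      "(\<lambda>\<rho>. \<rho> powr (D - 1) * \<bar>h' \<rho>\<bar>) integrable_on {0..R}"
  shows "integral {0..R} (\<lambda>\<rho>. \<rho> powr (Dr - 1) * \<bar>h \<rho>\<bar> powr q)
    \<le> integral {0..R} (\<lambda>\<rho>. \<rho> powr (D - 1) * \<bar>h' \<rho>\<bar>) powr q / Dr"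
proof (rule integral_le_from_tails[OF int(1) R])
  fix x assume x: "0 < x" "x \<le> R"
  define \<psi> where "\<psi> = (\<lambda>\<rho>. \<rho> powr (D - 1) * \<bar>h' \<rho>\<bar>)"
  define G where "G = (\<lambda>\<rho>. integral {\<rho>..R} (\<lambda>s. s powr (- (D - 1)) * \<psi> s))"
  have Dr: "Dr = (D - 1) * q" using D q(2) by (simp add: field_simps)
  have ch': "continuous_on A h'" for A using h(2) by (rule continuous_on_subset) auto
  have c\<psi>: "continuous_on {\<rho>..R} \<psi>" if "0 < \<rho>" for \<rho>
    unfolding \<psi>_def using that by (intro continuous_intros ch') auto
  have \<psi>_tail: "0 \<le> integral {x..R} \<psi>" "integral {x..R} \<psi> \<le> integral {0..R} \<psi>"
    using x int(2) integrable_continuous_real[OF c\<psi>[OF x(1)]] unfolding \<psi>_def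
    by (auto intro!: integral_subset_le Henstock_Kurzweil_Integration.integral_nonneg)
  have pw: "\<bar>h \<rho>\<bar> \<le> G \<rho>" if \<rho>: "\<rho> \<in> {x..R}" for \<rho>
  proof -
    have "G \<rho> = integral {\<rho>..R} (\<lambda>s. \<bar>h' s\<bar>)"
      unfolding G_def using \<rho> x
      by (intro integral_cong) (auto simp: \<psi>_def simp flip: powr_add mult.assoc)
    then show ?thesis using abs_le_integral_derivative[OF h, of \<rho>] \<rho> by simp
  qed
  have cG: "continuous_on {x..R} G"
    unfolding G_def using x c\<psi>[of x]
    by (intro indefinite_integral_continuous_1' integrable_continuous_real continuous_intros) auto
  have G0: "0 \<le> G \<rho>" if "\<rho> \<in> {x..R}" for \<rho> using pw[OF that] by linarith
  have "integral {x..R} (\<lambda>\<rho>. \<rho> powr (Dr - 1) * \<bar>h \<rho>\<bar> powr q)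
      \<le> integral {x..R} (\<lambda>\<rho>. \<rho> powr (Dr - 1) * G \<rho> powr q)"
  proof (rule integral_le)
    show "(\<lambda>\<rho>. \<rho> powr (Dr - 1) * \<bar>h \<rho>\<bar> powr q) integrable_on {x..R}"
      by (rule integrable_subinterval_real[OF int(1)]) (use x in auto)
    show "(\<lambda>\<rho>. \<rho> powr (Dr - 1) * G \<rho> powr q) integrable_on {x..R}"
      by (intro integrable_continuous_real continuous_intros continuous_on_powr' cG)
         (use x q(1) G0 in auto)
    fix \<rho> assume "\<rho> \<in> {x..R}"
    then show "\<rho> powr (Dr - 1) * \<bar>h \<rho>\<bar> powr q \<le> \<rho> powr (Dr - 1) * G \<rho> powr q"
      using q(1) pw by (intro mult_left_mono powr_mono2) auto
  qed
  also have "\<dots> \<le> integral {x..R} \<psi> powr q / Dr"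
    unfolding G_def Dr using x D q(1) c\<psi>[of x]
    by (intro weighted_Hardy_inequality) (auto simp: \<psi>_def)
  also have "\<dots> \<le> integral {0..R} \<psi> powr q / Dr"
    using D q(1) \<psi>_tail by (intro divide_right_mono powr_mono2) (auto simp: Dr)
  finally show "integral {x..R} (\<lambda>\<rho>. \<rho> powr (Dr - 1) * \<bar>h \<rho>\<bar> powr q)
    \<le> integral {0..R} (\<lambda>\<rho>. \<rho> powr (D - 1) * \<bar>h' \<rho>\<bar>) powr q / Dr"
    unfolding \<psi>_def .
qed

lemma radial_trace_ineq_upper:
  fixes A :: "real ^ 'd" and B :: "real ^ 'r"
  assumes D: "1 \<le> hdim A" "D = hdim A" and Dr: "1 \<le> hdim B" "Dr = hdim B"
    and p: "1 \<le> p" "p < D" and q: "p \<le> q" "q = p * Dr / (D - p)"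
  shows "radial_trace_ineq A B p q
    (Dr powr (- 1 / q) * rpow ((p - 1) / (D - p)) (1 - 1 / p) *
      (rpow (q / (q - 1)) (1 - 1 / p) * q powr (1 / q)))"
  unfolding radial_trace_ineq_def
proof (intro allI impI)
  fix f :: "real \<Rightarrow> real"
  assume "test_function (\<lambda>z::real^'d. f (norm z))"
  then obtain h h' R where R: "0 < R" and h: "\<And>t. (h has_real_derivative h' t) (at t)"
    "continuous_on UNIV h'" "\<And>t. R \<le> t \<Longrightarrow> h t = 0" "\<And>t. R \<le> t \<Longrightarrow> h' t = 0"
    "\<And>t. 0 < t \<Longrightarrow> f t = h t" "\<And>t. 0 < t \<Longrightarrow> deriv f t = h' t"
    by (rule test_function_profile) blast
  have "continuous_on UNIV h" using h(1) by (meson DERIV_isCont continuous_at_imp_continuous_on)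
  then have ch: "continuous_on {0..R} h" by (rule continuous_on_subset) auto
  have ch': "continuous_on {0..R} h'" using h(2) by (rule continuous_on_subset) auto
  have q1: "1 \<le> q" using p q by linarith
  define I where "I = integral {0..R} (\<lambda>\<rho>. \<rho> powr (Dr - 1) * \<bar>h \<rho>\<bar> powr q)"
  define J where "J = integral {0..R} (\<lambda>\<rho>. \<rho> powr (D - 1) * \<bar>h' \<rho>\<bar> powr p)"
  have I: "(LBINT \<rho>:{0<..}. \<rho> powr (hdim B - 1) * \<bar>f \<rho>\<bar> powr q) = I"
    "(\<lambda>\<rho>. \<rho> powr (Dr - 1) * \<bar>h \<rho>\<bar> powr q) integrable_on {0..R}"
    unfolding I_def Dr using weighted_integral_half_line[OF ch h(3,5), of "hdim B - 1" q] Dr q1 by auto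
  have J: "(LBINT \<rho>:{0<..}. \<rho> powr (hdim A - 1) * \<bar>deriv f \<rho>\<bar> powr p) = J"
    "(\<lambda>\<rho>. \<rho> powr (D - 1) * \<bar>h' \<rho>\<bar> powr p) integrable_on {0..R}"
    unfolding J_def D using weighted_integral_half_line[OF ch' h(4,6), of "hdim A - 1" p] D p by auto
  have nn: "0 \<le> I" "0 \<le> J"
    unfolding I_def J_def using I(2) J(2)
    by (auto intro!: Henstock_Kurzweil_Integration.integral_nonneg)
  have pDp: "p / (D - p) = q * (1 / Dr)" using p Dr q(2) by (simp add: field_simps)
  have "I powr (1 / q) \<le>
     Dr powr (- 1 / q) * rpow ((p - 1) / (D - p)) (1 - 1 / p) *
      (rpow (q / (q - 1)) (1 - 1 / p) * q powr (1 / q)) * J powr (1 / p)"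
  proof (cases "p = 1")
    case True
    have "I \<le> J powr q / Dr"
      unfolding I_def J_def using True radial_Sobolev_bound_L1[OF h(1,2) h(3)[OF order_refl] R, of D q Dr] I(2) J(2) p q by simp
    then have "I powr (1 / q) \<le> (J powr q / Dr) powr (1 / q)"
      using nn q1 by (intro powr_mono2) auto
    also have "\<dots> = Dr powr (- 1 / q) * J"
      using nn q1 Dr by (simp add: powr_divide powr_powr powr_minus_divide)
    also have "\<dots> \<le> Dr powr (- 1 / q) * J * q powr (1 / q)"
    proof -
      have "Dr powr (- 1 / q) * J * 1 \<le> Dr powr (- 1 / q) * J * q powr (1 / q)"
        using nn q1 ge_one_powr_ge_zero[of q "1 / q"] by (intro mult_left_mono) auto
      then show ?thesis by simp
    qed
    finally show ?thesis using True nn by (simp add: rpow_def mult_ac)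
  next
    case False
    then have p1: "1 < p" using p by simp
    have e: "1 - 1 / p \<noteq> 0" using p1 by simp
    have "I \<le> (q / (q - 1) * ((p - 1) / (D - p))) powr (q * (1 - 1 / p)) * (q * (1 / Dr)) * J powr (q / p)"
      unfolding I_def J_def pDp[symmetric]
      by (rule radial_Sobolev_bound[OF h(1,2) h(3)[OF order_refl] R p1 p(2) q I(2) J(2)])
    then have "I powr (1 / q) \<le>
      ((q / (q - 1) * ((p - 1) / (D - p))) powr (q * (1 - 1 / p)) * (q * (1 / Dr)) * J powr (q / p)) powr (1 / q)"
      using nn q1 by (intro powr_mono2) auto
    also have "\<dots> = (q / (q - 1)) powr (1 - 1 / p) * ((p - 1) / (D - p)) powr (1 - 1 / p)
        * (q powr (1 / q) * Dr powr (- 1 / q)) * J powr (1 / p)"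
      using nn q1 p1 p Dr by (simp only: powr_mult powr_powr) (simp add: powr_divide powr_minus_divide)
    finally show ?thesis using False e by (simp add: rpow_def mult_ac)
  qed
  then show "(LBINT \<rho>:{0<..}. \<rho> powr (hdim B - 1) * \<bar>f \<rho>\<bar> powr q) powr (1 / q) \<le>
      Dr powr (- 1 / q) * rpow ((p - 1) / (D - p)) (1 - 1 / p) *
      (rpow (q / (q - 1)) (1 - 1 / p) * q powr (1 / q)) *
      (LBINT \<rho>:{0<..}. \<rho> powr (hdim A - 1) * \<bar>deriv f \<rho>\<bar> powr p) powr (1 / p)"
    unfolding I(1) J(1) .
qed

section \<open>The lower bound\<close>
text \<open>
  The test profile decreases from its constant value on \<open>{0..1}\<close> with slope \<open>- g\<close>. On
  the left only the contribution of \<open>{0..1}\<close> is kept, which is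
  \<open>f 1 powr q / Dr\<close> with \<open>f 1\<close> the integral of \<open>g\<close>. What remains is a one-weight
  inequality for \<open>g\<close> whose extremal is explicit.
\<close>
lemma decreasing_profile_test:
  fixes A :: "real ^ 'd" and B :: "real ^ 'r"
  assumes ineq: "radial_trace_ineq A B p q C"
    and D: "1 \<le> hdim A" "D = hdim A" and Dr: "1 \<le> hdim B" "Dr = hdim B" and p: "0 < p" and q: "0 < q"
    and G: "G \<in> flat_algebra" "\<And>t. 0 \<le> G t" "\<And>t. t \<le> 1 \<Longrightarrow> G t = 0" "\<And>t. R\<^sup>2 \<le> t \<Longrightarrow> G t = 0"
    and R: "1 < R" and g: "g = (\<lambda>\<rho>. 2 * \<rho> * G (\<rho>\<^sup>2))"
  shows "Dr powr (- 1 / q) * integral {1..R} g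
    \<le> C * integral {1..R} (\<lambda>\<rho>. \<rho> powr (D - 1) * g \<rho> powr p) powr (1 / p)"
proof -
  have G': "(\<lambda>t. (- 1) * G t) \<in> flat_algebra" by (intro flat_algebra.intros G)
  obtain \<psi> where \<psi>: "\<And>t. (\<psi> has_real_derivative (- 1) * G t) (at t)" "\<psi> (R\<^sup>2) = 0"
    using flat_algebra_antiderivative[OF G', of "R\<^sup>2"] by blast
  have \<psi>0: "\<psi> t = 0" if "R\<^sup>2 \<le> t" for t
  proof -
    have "(\<psi> has_real_derivative 0) (at s within {R\<^sup>2..})" if "s \<in> {R\<^sup>2..}" for s
      using has_field_derivative_at_within[OF \<psi>(1)[of s]] G(4)[of s] that by simp
    then obtain c where "\<And>s. s \<in> {R\<^sup>2..} \<Longrightarrow> \<psi> s = c"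
      using has_field_derivative_zero_constant[OF convex_real_interval(1)] by blast
    then show ?thesis using that \<psi>(2) by (metis atLeast_iff order_refl)
  qed
  define f where "f = (\<lambda>\<rho>. \<psi> (\<rho>\<^sup>2))"
  have test: "test_function (\<lambda>z::real^'d. f (norm z))"
    unfolding f_def
    by (rule test_function_radial[OF derivative_closed_insert[OF flat_algebra_derivative_closed G' \<psi>(1)] _ \<psi>0]) auto
  have df: "(f has_real_derivative - g \<rho>) (at \<rho>)" for \<rho>
    unfolding f_def g by (rule DERIV_chain2[OF \<psi>(1), THEN DERIV_cong]) (auto intro!: derivative_eq_intros)
  have cf: "continuous_on S f" for S using df by (meson DERIV_isCont continuous_at_imp_continuous_on)
  have cg: "continuous_on S g" for S
    unfolding g by (intro continuous_intros continuous_on_compose2[OF flat_algebra_continuous[OF G(1)]]) auto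
  have sq: "R\<^sup>2 \<le> \<rho>\<^sup>2" if "R \<le> \<rho>" for \<rho> using that R by (intro power_mono) auto
  have f0: "f \<rho> = 0" if "R \<le> \<rho>" for \<rho> using \<psi>0 sq[OF that] by (simp add: f_def)
  have g0: "g \<rho> = 0" if "R \<le> \<rho>" for \<rho> using G(4) sq[OF that] by (simp add: g)
  have g1: "g \<rho> = 0" if "0 \<le> \<rho>" "\<rho> \<le> 1" for \<rho> using G(3)[of "\<rho>\<^sup>2"] that by (simp add: g power_le_one)
  have gnn: "0 \<le> g \<rho>" if "0 \<le> \<rho>" for \<rho> using G(2) that by (simp add: g)
  have FTC: "((\<lambda>\<rho>. - g \<rho>) has_integral f b - f a) {a..b}" if "a \<le> b" for a b
    using that by (intro fundamental_theorem_of_calculus)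
      (auto intro!: DERIV_subset[OF df] simp flip: has_real_derivative_iff_has_vector_derivative)
  have f1: "f 1 = integral {1..R} g"
    using integral_unique[OF FTC[of 1 R]] R f0[of R] by simp
  have f1nn: "0 \<le> f 1"
    unfolding f1
    by (rule Henstock_Kurzweil_Integration.integral_nonneg[OF integrable_continuous_real[OF cg]])
       (simp add: gnn)
  have fc: "f \<rho> = f 1" if "0 \<le> \<rho>" "\<rho> \<le> 1" for \<rho>
  proof -
    have "integral {\<rho>..1} (\<lambda>\<rho>. - g \<rho>) = integral {\<rho>..1} (\<lambda>\<rho>. 0)"
      using g1 that by (intro integral_cong) auto
    then show ?thesis using integral_unique[OF FTC[of \<rho> 1]] that by simp
  qed
  have wf: "(\<lambda>\<rho>. \<rho> powr (Dr - 1) * \<bar>f \<rho>\<bar> powr q) integrable_on {0..R}"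
    "(LBINT \<rho>:{0<..}. \<rho> powr (Dr - 1) * \<bar>f \<rho>\<bar> powr q) = integral {0..R} (\<lambda>\<rho>. \<rho> powr (Dr - 1) * \<bar>f \<rho>\<bar> powr q)"
    by (rule weighted_integral_half_line[OF cf f0 refl]; use Dr q in simp)+
  have "((\<lambda>\<rho>. \<rho> powr (Dr - 1)) has_integral 1 / Dr) {0..1}"
    using has_integral_powr_from_0[of "Dr - 1" 1] Dr by simp
  then have "((\<lambda>\<rho>. \<rho> powr (Dr - 1) * \<bar>f 1\<bar> powr q) has_integral 1 / Dr * \<bar>f 1\<bar> powr q) {0..1}"
    by (rule has_integral_mult_left)
  then have "((\<lambda>\<rho>. \<rho> powr (Dr - 1) * \<bar>f \<rho>\<bar> powr q) has_integral 1 / Dr * \<bar>f 1\<bar> powr q) {0..1}"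
    by (rule has_integral_eq[rotated]) (metis fc atLeastAtMost_iff)
  then have "1 / Dr * \<bar>f 1\<bar> powr q \<le> integral {0..R} (\<lambda>\<rho>. \<rho> powr (Dr - 1) * \<bar>f \<rho>\<bar> powr q)"
    by (rule has_integral_subset_le[OF _ _ integrable_integral[OF wf(1)], rotated]) (use R in auto)
  also have "\<dots> = (LBINT \<rho>:{0<..}. \<rho> powr (Dr - 1) * \<bar>f \<rho>\<bar> powr q)"
    using wf(2) by simp
  finally have "(1 / Dr * \<bar>f 1\<bar> powr q) powr (1 / q) \<le>
      (LBINT \<rho>:{0<..}. \<rho> powr (Dr - 1) * \<bar>f \<rho>\<bar> powr q) powr (1 / q)"
    using Dr q by (intro powr_mono2) auto
  also have "(1 / Dr * \<bar>f 1\<bar> powr q) powr (1 / q) = Dr powr (- 1 / q) * f 1"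
    using Dr q f1nn by (simp add: powr_mult powr_powr powr_divide powr_minus_divide)
  also have "(LBINT \<rho>:{0<..}. \<rho> powr (Dr - 1) * \<bar>f \<rho>\<bar> powr q) powr (1 / q)
      \<le> C * (LBINT \<rho>:{0<..}. \<rho> powr (D - 1) * \<bar>deriv f \<rho>\<bar> powr p) powr (1 / p)"
    using ineq test unfolding radial_trace_ineq_def D Dr by blast
  also have "(\<lambda>\<rho>. deriv f \<rho>) = (\<lambda>\<rho>. - g \<rho>)" using df by (auto intro: DERIV_imp_deriv)
  also have "(LBINT \<rho>:{0<..}. \<rho> powr (D - 1) * \<bar>- g \<rho>\<bar> powr p)
      = integral {0..R} (\<lambda>\<rho>. \<rho> powr (D - 1) * \<bar>g \<rho>\<bar> powr p)"
    unfolding abs_minus_cancel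
    by (rule weighted_integral_half_line(2)[OF cg g0 refl]) (use D p in simp_all)
  also have "\<dots> = integral {0..1} (\<lambda>\<rho>. \<rho> powr (D - 1) * \<bar>g \<rho>\<bar> powr p)
      + integral {1..R} (\<lambda>\<rho>. \<rho> powr (D - 1) * \<bar>g \<rho>\<bar> powr p)"
  proof (rule Henstock_Kurzweil_Integration.integral_combine[symmetric])
    show "(\<lambda>\<rho>. \<rho> powr (D - 1) * \<bar>g \<rho>\<bar> powr p) integrable_on {0..R}"
      by (rule weighted_integral_half_line[OF cg g0 refl]) (use D p in simp_all)
  qed (use R in auto)
  also have "integral {0..1} (\<lambda>\<rho>. \<rho> powr (D - 1) * \<bar>g \<rho>\<bar> powr p) = integral {0..1} (\<lambda>\<rho>::real. 0)"
    using g1 p by (intro integral_cong) auto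
  also have "integral {1..R} (\<lambda>\<rho>. \<rho> powr (D - 1) * \<bar>g \<rho>\<bar> powr p) =
      integral {1..R} (\<lambda>\<rho>. \<rho> powr (D - 1) * g \<rho> powr p)"
    using gnn by (intro integral_cong) auto
  finally show ?thesis by (simp add: f1)
qed

text \<open>
  Equality in Hoelder's inequality on \<open>{1..}\<close> occurs for the slope
  \<open>\<rho> powr (- \<gamma> - 1)\<close> with \<open>\<gamma> = (D - p) / (p - 1)\<close>, because
  \<open>(\<gamma> + 1) * (p - 1) = D - 1\<close>. It is approximated from below by \<open>g\<close>, its product with
  the two cutoffs at \<open>1\<close> and at \<open>R = b + 1\<close>; on \<open>{a..b}\<close> these are at least
  \<open>\<kappa> \<eta> a b\<close>. The limits \<open>\<eta>\<close> to \<open>0\<close>, \<open>a\<close> to \<open>1\<close> and \<open>b\<close> to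
  infinity, in this order, give the claim.
\<close>
lemma radial_trace_const_lower_bound:
  fixes A :: "real ^ 'd" and B :: "real ^ 'r"
  assumes ineq: "radial_trace_ineq A B p q C"
    and D: "1 \<le> hdim A" "D = hdim A" and Dr: "1 \<le> hdim B" "Dr = hdim B"
    and p: "1 < p" "p < D" and q: "0 < q"
  shows "Dr powr (- 1 / q) * ((p - 1) / (D - p)) powr (1 - 1 / p) \<le> C"
proof -
  define \<gamma> where "\<gamma> = (D - p) / (p - 1)"
  have \<gamma>: "0 < \<gamma>" using p by (simp add: \<gamma>_def)
  define \<kappa> where "\<kappa> = (\<lambda>\<eta> a b :: real. exp (- \<eta> / (a\<^sup>2 - 1)) * exp (- \<eta> / ((b + 1)\<^sup>2 - b\<^sup>2)))"
  have test: "\<exists>X\<ge>0. X \<le> 1 / \<gamma> \<and>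
      Dr powr (- 1 / q) * (\<kappa> \<eta> a b * ((a powr (- \<gamma>) - b powr (- \<gamma>)) / \<gamma>)) \<le> C * X powr (1 / p)"
    if ab: "1 < a" "a < b" and \<eta>: "0 < \<eta>" for \<eta> a b
  proof -
    define R where "R = b + 1"
    define G where "G = (\<lambda>t. 1 / 2 * (flat \<eta> (- (\<gamma> + 2) / 2) 0 (1 * t + - 1) * flat \<eta> 0 0 ((- 1) * t + R\<^sup>2)))"
    define \<omega> where "\<omega> = (\<lambda>\<rho>. exp (- \<eta> / (\<rho>\<^sup>2 - 1)) * exp (- \<eta> / (R\<^sup>2 - \<rho>\<^sup>2)))"
    define g where "g = (\<lambda>\<rho>. 2 * \<rho> * G (\<rho>\<^sup>2))"
    have R: "1 < R" using ab by (simp add: R_def)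
    have G: "G \<in> flat_algebra" unfolding G_def by (intro flat_algebra.intros \<eta>)
    have Gnn: "0 \<le> G t" for t by (simp add: G_def flat_def)
    have G0: "G t = 0" if "t \<le> 1 \<or> R\<^sup>2 \<le> t" for t using that by (auto simp: G_def flat_def)
    have g_eq: "g \<rho> = \<rho> powr (- \<gamma> - 1) * \<omega> \<rho>" if "1 < \<rho>" "\<rho> < R" for \<rho>
    proof -
      have 1: "1 < \<rho>\<^sup>2" using that(1) by simp
      have 2: "\<rho>\<^sup>2 < R\<^sup>2" using that by (intro power_strict_mono) auto
      have "\<rho> * (\<rho>\<^sup>2) powr (- (\<gamma> + 2) / 2) = \<rho> powr 1 * \<rho> powr (- (\<gamma> + 2))"
        using that by (simp add: powr_powr add_divide_distrib diff_divide_distrib flip: powr_numeral)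
      also have "\<dots> = \<rho> powr (1 + - (\<gamma> + 2))" by (rule powr_add[symmetric])
      also have "1 + - (\<gamma> + 2) = - \<gamma> - 1" by simp
      finally have 3: "\<rho> * (\<rho>\<^sup>2) powr (- (\<gamma> + 2) / 2) = \<rho> powr (- \<gamma> - 1)" .
      show ?thesis
        using 1 2 unfolding g_def G_def flat_def \<omega>_def 3[symmetric] by simp
    qed
    have \<omega>: "0 \<le> \<omega> \<rho>" "\<omega> \<rho> \<le> 1" if "1 < \<rho>" "\<rho> < R" for \<rho>
    proof -
      have "1 < \<rho>\<^sup>2" "\<rho>\<^sup>2 < R\<^sup>2" using that by (auto intro!: power_strict_mono)
      then show "\<omega> \<rho> \<le> 1" using \<eta> unfolding \<omega>_def by (intro mult_le_one) auto
    qed (simp add: \<omega>_def)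
    have g_le: "0 \<le> g \<rho> \<and> g \<rho> \<le> \<rho> powr (- \<gamma> - 1)" if "\<rho> \<in> {1..R}" for \<rho>
    proof (cases "\<rho> = 1 \<or> \<rho> = R")
      case True
      then show ?thesis using G0[of "\<rho>\<^sup>2"] by (auto simp: g_def)
    next
      case False
      then have "1 < \<rho>" "\<rho> < R" using that by auto
      with \<omega>[of \<rho>] show ?thesis
        by (simp add: g_eq mult_left_le)
    qed
    have cg: "continuous_on S g" for S
      unfolding g_def by (intro continuous_intros continuous_on_compose2[OF flat_algebra_continuous[OF G]]) auto
    define X where "X = integral {1..R} (\<lambda>\<rho>. \<rho> powr (D - 1) * g \<rho> powr p)"
    have iX: "(\<lambda>\<rho>. \<rho> powr (D - 1) * g \<rho> powr p) integrable_on {1..R}"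
      using g_le p by (intro integrable_continuous_real continuous_intros continuous_on_powr' cg) auto
    have X0: "0 \<le> X"
      unfolding X_def using iX by (intro Henstock_Kurzweil_Integration.integral_nonneg) auto
    have "X \<le> integral {1..R} (\<lambda>\<rho>. \<rho> powr (- \<gamma> - 1))"
      unfolding X_def
    proof (rule integral_le[OF iX])
      show "(\<lambda>\<rho>. \<rho> powr (- \<gamma> - 1)) integrable_on {1..R}"
        by (intro integrable_continuous_real continuous_intros) auto
      fix \<rho> assume \<rho>: "\<rho> \<in> {1..R}"
      \<comment> \<open>The extremal slope solves \<open>\<rho> powr (D - 1) * g powr p = g\<close>.\<close>
      have e: "(D - 1) + (- \<gamma> - 1) * p = - \<gamma> - 1"
        using p by (simp add: \<gamma>_def field_simps)
      have "\<rho> powr (D - 1) * g \<rho> powr p \<le> \<rho> powr (D - 1) * (\<rho> powr (- \<gamma> - 1)) powr p"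
        using g_le[OF \<rho>] p by (intro mult_left_mono powr_mono2) auto
      also have "\<dots> = \<rho> powr (- \<gamma> - 1)"
        by (simp only: powr_powr powr_add[symmetric] e)
      finally show "\<rho> powr (D - 1) * g \<rho> powr p \<le> \<rho> powr (- \<gamma> - 1)" .
    qed
    also have "\<dots> \<le> 1 / \<gamma>" using integral_powr_le[OF \<gamma>, of 1 R] R by simp
    finally have X1: "X \<le> 1 / \<gamma>" .
    have "((\<lambda>s. s powr (- \<gamma> - 1)) has_integral (- (b powr (- \<gamma>)) / \<gamma>) - (- (a powr (- \<gamma>)) / \<gamma>)) {a..b}"
      using ab \<gamma> by (intro fundamental_theorem_of_calculus)
        (auto intro!: derivative_eq_intros simp flip: has_real_derivative_iff_has_vector_derivative)
    then have "((\<lambda>s. s powr (- \<gamma> - 1)) has_integral (a powr (- \<gamma>) - b powr (- \<gamma>)) / \<gamma>) {a..b}"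
      by (simp add: diff_divide_distrib)
    then have "((\<lambda>s. \<kappa> \<eta> a b * s powr (- \<gamma> - 1)) has_integral
        \<kappa> \<eta> a b * ((a powr (- \<gamma>) - b powr (- \<gamma>)) / \<gamma>)) {a..b}"
      by (rule has_integral_mult_right)
    then have "\<kappa> \<eta> a b * ((a powr (- \<gamma>) - b powr (- \<gamma>)) / \<gamma>) \<le> integral {a..b} g"
    proof (rule has_integral_le[OF _ integrable_integral])
      show "g integrable_on {a..b}" by (intro integrable_continuous_real cg)
      fix \<rho> assume \<rho>: "\<rho> \<in> {a..b}"
      have 1: "a\<^sup>2 \<le> \<rho>\<^sup>2" "\<rho>\<^sup>2 \<le> b\<^sup>2" using \<rho> ab by (auto intro!: power_mono)
      have 2: "1 < a\<^sup>2" "b\<^sup>2 < R\<^sup>2" using ab by (auto simp: R_def intro!: power_strict_mono)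
      have "\<kappa> \<eta> a b \<le> \<omega> \<rho>"
        unfolding \<kappa>_def \<omega>_def R_def[symmetric] using 1 2 \<eta>
        by (intro mult_mono) (auto simp: frac_le)
      then show "\<kappa> \<eta> a b * \<rho> powr (- \<gamma> - 1) \<le> g \<rho>"
        using \<rho> ab by (simp add: g_eq R_def mult.commute mult_right_mono)
    qed
    also have "\<dots> \<le> integral {1..R} g"
      using ab g_le by (intro integral_subset_le integrable_continuous_real cg) (auto simp: R_def)
    finally have "Dr powr (- 1 / q) * (\<kappa> \<eta> a b * ((a powr (- \<gamma>) - b powr (- \<gamma>)) / \<gamma>))
        \<le> Dr powr (- 1 / q) * integral {1..R} g" by (rule mult_left_mono) auto
    also have "\<dots> \<le> C * X powr (1 / p)"
      unfolding X_def using p q G0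
      by (intro decreasing_profile_test[OF ineq D Dr _ q G Gnn _ _ R g_def]) auto
    finally show ?thesis using X0 X1 by blast
  qed
  \<comment> \<open>Only for a nonnegative constant may the gradient term be replaced by its upper bound.\<close>
  have C0: "0 \<le> C"
  proof (rule ccontr)
    assume "\<not> 0 \<le> C"
    obtain X where X: "Dr powr (- 1 / q) * (\<kappa> 1 2 3 * ((2 powr (- \<gamma>) - 3 powr (- \<gamma>)) / \<gamma>)) \<le> C * X powr (1 / p)"
      using test[of 2 3 1] by auto
    have "0 < Dr powr (- 1 / q) * (\<kappa> 1 2 3 * ((2 powr (- \<gamma>) - 3 powr (- \<gamma>)) / \<gamma>))"
      using \<gamma> Dr by (auto simp: \<kappa>_def powr_less_mono2_neg intro!: mult_pos_pos divide_pos_pos)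
    moreover have "C * X powr (1 / p) \<le> 0"
      using \<open>\<not> 0 \<le> C\<close> by (simp add: mult_nonpos_nonneg)
    ultimately show False using X by linarith
  qed
  define K where "K = C * (1 / \<gamma>) powr (1 / p)"
  have K1: "Dr powr (- 1 / q) * (\<kappa> \<eta> a b * ((a powr (- \<gamma>) - b powr (- \<gamma>)) / \<gamma>)) \<le> K"
    if ab: "1 < a" "a < b" "0 < \<eta>" for \<eta> a b
  proof -
    obtain X where "0 \<le> X" "X \<le> 1 / \<gamma>"
      and X: "Dr powr (- 1 / q) * (\<kappa> \<eta> a b * ((a powr (- \<gamma>) - b powr (- \<gamma>)) / \<gamma>)) \<le> C * X powr (1 / p)"
      using test[OF ab] by blast
    then have "C * X powr (1 / p) \<le> K"
      unfolding K_def using C0 p by (intro mult_left_mono powr_mono2) auto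
    with X show ?thesis by linarith
  qed
  have K2: "Dr powr (- 1 / q) * ((a powr (- \<gamma>) - b powr (- \<gamma>)) / \<gamma>) \<le> K" if "1 < a" "a < b" for a b
  proof -
    have "((\<lambda>\<eta>. \<kappa> \<eta> a b) \<longlongrightarrow> exp (- 0 / (a\<^sup>2 - 1)) * exp (- 0 / ((b + 1)\<^sup>2 - b\<^sup>2))) (at_right 0)"
      unfolding \<kappa>_def divide_inverse by (intro tendsto_intros)
    then have "((\<lambda>\<eta>. Dr powr (- 1 / q) * (\<kappa> \<eta> a b * ((a powr (- \<gamma>) - b powr (- \<gamma>)) / \<gamma>))) \<longlongrightarrow>
        Dr powr (- 1 / q) * (1 * ((a powr (- \<gamma>) - b powr (- \<gamma>)) / \<gamma>))) (at_right 0)"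
      by (intro tendsto_mult tendsto_const) simp
    then have "Dr powr (- 1 / q) * (1 * ((a powr (- \<gamma>) - b powr (- \<gamma>)) / \<gamma>)) \<le> K"
      by (rule tendsto_upperbound) (use K1[OF that] in \<open>auto simp: eventually_at_filter\<close>)
    then show ?thesis by simp
  qed
  have K3: "Dr powr (- 1 / q) * ((1 - b powr (- \<gamma>)) / \<gamma>) \<le> K" if b: "1 < b" for b
  proof -
    have "((\<lambda>a. Dr powr (- 1 / q) * ((a powr (- \<gamma>) - b powr (- \<gamma>)) / \<gamma>)) \<longlongrightarrow>
        Dr powr (- 1 / q) * ((1 powr (- \<gamma>) - b powr (- \<gamma>)) / \<gamma>)) (at_right 1)"
      using \<gamma> by (intro tendsto_intros) auto
    moreover have "\<forall>\<^sub>F a in at_right 1. Dr powr (- 1 / q) * ((a powr (- \<gamma>) - b powr (- \<gamma>)) / \<gamma>) \<le> K"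
      using eventually_at_right_real[OF b] by eventually_elim (use K2 in auto)
    ultimately have "Dr powr (- 1 / q) * ((1 powr (- \<gamma>) - b powr (- \<gamma>)) / \<gamma>) \<le> K"
      by (rule tendsto_upperbound) simp
    then show ?thesis by simp
  qed
  have "((\<lambda>b. Dr powr (- 1 / q) * ((1 - b powr (- \<gamma>)) / \<gamma>)) \<longlongrightarrow> Dr powr (- 1 / q) * ((1 - 0) / \<gamma>)) at_top"
    using \<gamma> by (intro tendsto_intros tendsto_neg_powr filterlim_ident) auto
  moreover have "\<forall>\<^sub>F b in at_top. Dr powr (- 1 / q) * ((1 - b powr (- \<gamma>)) / \<gamma>) \<le> K"
    using eventually_gt_at_top[of 1] by eventually_elim (rule K3)
  ultimately have "Dr powr (- 1 / q) * ((1 - 0) / \<gamma>) \<le> K"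
    by (rule tendsto_upperbound) simp
  then have "Dr powr (- 1 / q) * (1 / \<gamma>) \<le> C * (1 / \<gamma>) powr (1 / p)"
    by (simp add: K_def)
  moreover have "1 / \<gamma> = (1 / \<gamma>) powr (1 - 1 / p) * (1 / \<gamma>) powr (1 / p)"
    using \<gamma> by (simp flip: powr_add)
  ultimately have "(Dr powr (- 1 / q) * (1 / \<gamma>) powr (1 - 1 / p)) * (1 / \<gamma>) powr (1 / p)
      \<le> C * (1 / \<gamma>) powr (1 / p)" by (metis mult.assoc)
  then have "Dr powr (- 1 / q) * (1 / \<gamma>) powr (1 - 1 / p) \<le> C"
    using \<gamma> by (simp add: mult_le_cancel_right)
  then show ?thesis by (simp add: \<gamma>_def)
qed

text \<open>
  For \<open>p = 1\<close> the supremum is approached by slopes concentrated at \<open>1\<close>: on \<open>{1..R}\<close> the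
  weight is at most \<open>R powr (D - 1)\<close>, which tends to \<open>1\<close>.
\<close>
lemma radial_trace_const_lower_bound_L1:
  fixes A :: "real ^ 'd" and B :: "real ^ 'r"
  assumes ineq: "radial_trace_ineq A B 1 q C"
    and D: "1 \<le> hdim A" "D = hdim A" and Dr: "1 \<le> hdim B" "Dr = hdim B" and q: "0 < q"
  shows "Dr powr (- 1 / q) \<le> C"
proof -
  have test: "Dr powr (- 1 / q) \<le> C * R powr (D - 1)" if R: "1 < R" for R
  proof -
    define G where "G = (\<lambda>t. flat 1 0 0 (1 * t + - 1) * flat 1 0 0 ((- 1) * t + R\<^sup>2))"
    define g where "g = (\<lambda>\<rho>. 2 * \<rho> * G (\<rho>\<^sup>2))"
    have G: "G \<in> flat_algebra" unfolding G_def by (intro flat_algebra.intros) auto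
    have Gnn: "0 \<le> G t" for t by (simp add: G_def flat_def)
    have G0: "G t = 0" if "t \<le> 1 \<or> R\<^sup>2 \<le> t" for t using that by (auto simp: G_def flat_def)
    have cg: "continuous_on S g" for S
      unfolding g_def by (intro continuous_intros continuous_on_compose2[OF flat_algebra_continuous[OF G]]) auto
    have gnn: "0 \<le> g \<rho>" if "\<rho> \<in> {1..R}" for \<rho> using that Gnn by (simp add: g_def)
    define S where "S = integral {1..R} g"
    have ig: "g integrable_on {1..R}" by (intro integrable_continuous_real cg)
    have "S \<noteq> 0"
    proof
      assume "S = 0"
      then have "g ((1 + R) / 2) = 0"
        using integral_eq_0_iff[OF cg R gnn] R unfolding S_def by auto
      moreover have "1 < ((1 + R) / 2)\<^sup>2" "((1 + R) / 2)\<^sup>2 < R\<^sup>2"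
        using R by (auto intro!: power_strict_mono)
      ultimately show False using R by (auto simp: g_def G_def flat_def)
    qed
    moreover have "0 \<le> S"
      unfolding S_def by (rule Henstock_Kurzweil_Integration.integral_nonneg[OF ig gnn])
    ultimately have S: "0 < S" by simp
    define X where "X = integral {1..R} (\<lambda>\<rho>. \<rho> powr (D - 1) * g \<rho>)"
    have iX: "(\<lambda>\<rho>. \<rho> powr (D - 1) * g \<rho>) integrable_on {1..R}"
      by (intro integrable_continuous_real continuous_intros cg) auto
    have X0: "0 \<le> X"
      unfolding X_def using gnn by (intro Henstock_Kurzweil_Integration.integral_nonneg[OF iX]) auto
    have "X \<le> integral {1..R} (\<lambda>\<rho>. R powr (D - 1) * g \<rho>)"
      unfolding X_def using D gnn
      by (intro integral_le[OF iX] integrable_continuous_real continuous_intros cg mult_right_mono powr_mono2) auto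
    then have X1: "X \<le> R powr (D - 1) * S" by (simp add: S_def)
    have "integral {1..R} (\<lambda>\<rho>. \<rho> powr (D - 1) * g \<rho> powr 1) = X"
      unfolding X_def using gnn by (intro integral_cong) auto
    then have key: "Dr powr (- 1 / q) * S \<le> C * X"
      using decreasing_profile_test[OF ineq D Dr _ q G Gnn _ _ R g_def] G0 X0 by (simp add: S_def)
    have "0 < Dr powr (- 1 / q) * S" using S Dr by simp
    with key X0 have "0 \<le> C" by (smt (verit) mult_nonneg_nonneg mult_minus_left)
    then have "C * X \<le> C * (R powr (D - 1) * S)" using X1 by (intro mult_left_mono) auto
    with key have "Dr powr (- 1 / q) * S \<le> (C * R powr (D - 1)) * S" by simp
    then show ?thesis using S by (simp only: mult_le_cancel_right_pos)
  qed
  have "((\<lambda>R. C * R powr (D - 1)) \<longlongrightarrow> C * 1 powr (D - 1)) (at_right 1)"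
    by (intro tendsto_intros) auto
  moreover have "\<forall>\<^sub>F R in at_right 1. Dr powr (- 1 / q) \<le> C * R powr (D - 1)"
    using test by (auto simp: eventually_at_filter)
  ultimately have "Dr powr (- 1 / q) \<le> C * 1 powr (D - 1)"
    by (rule tendsto_lowerbound) simp
  then show ?thesis by simp
qed

section \<open>Failure of the inequality for q smaller than p\<close>
lemma abs_sum_powr_disjoint:
  fixes a :: "'i \<Rightarrow> real"
  assumes "finite I" and "\<And>i j. i \<in> I \<Longrightarrow> j \<in> I \<Longrightarrow> i \<noteq> j \<Longrightarrow> a i = 0 \<or> a j = 0" and "0 < s"
  shows "\<bar>\<Sum>i\<in>I. a i\<bar> powr s = (\<Sum>i\<in>I. \<bar>a i\<bar> powr s)"
proof (cases "\<exists>i\<in>I. a i \<noteq> 0")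
  case True
  then obtain i where i: "i \<in> I" "a i \<noteq> 0" by blast
  have "a j = 0" if "j \<in> I - {i}" for j using assms(2)[of i j] i that by auto
  then have "(\<Sum>j\<in>I - {i}. a j) = 0" "(\<Sum>j\<in>I - {i}. \<bar>a j\<bar> powr s) = 0"
    by (auto intro!: sum.neutral)
  then show ?thesis
    using sum.remove[OF assms(1) i(1), of a] sum.remove[OF assms(1) i(1), of "\<lambda>j. \<bar>a j\<bar> powr s"] by simp
qed auto

text \<open>
  The summands have disjoint supports \<open>{2 ^ k..2 ^ (k + 1)}\<close>, so the power of the sum is the
  sum of the powers, and by the choice of \<open>\<nu>\<close> all of them have the same integral.
\<close>
lemma dyadic_sum_integral:
  fixes \<phi> :: "real \<Rightarrow> real"
  assumes \<phi>: "continuous_on UNIV \<phi>" "\<And>t. 0 \<le> t \<Longrightarrow> t \<le> 1 \<or> 2 \<le> t \<Longrightarrow> \<phi> t = 0"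
    and a: "0 \<le> a" and s: "0 < s" and \<nu>: "0 < \<nu>" "\<nu> powr s * 2 powr (a + 1) = 1"
  shows "(LBINT \<rho>:{0<..}. \<rho> powr a * \<bar>\<Sum>k<N. \<nu> ^ k * \<phi> (\<rho> / 2 ^ k)\<bar> powr s)
    = real N * (LBINT \<rho>:{0<..}. \<rho> powr a * \<bar>\<phi> \<rho>\<bar> powr s)"
proof -
  define F where "F = (\<lambda>k \<rho>. \<rho> powr a * \<bar>\<nu> ^ k * \<phi> (\<rho> / 2 ^ k)\<bar> powr s)"
  have split: "\<rho> powr a * \<bar>\<Sum>k<N. \<nu> ^ k * \<phi> (\<rho> / 2 ^ k)\<bar> powr s = (\<Sum>k<N. F k \<rho>)"
    if \<rho>: "0 < \<rho>" for \<rho>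
  proof -
    have "\<phi> (\<rho> / 2 ^ i) = 0 \<or> \<phi> (\<rho> / 2 ^ j) = 0" if "i < j" for i j :: nat
    proof (rule ccontr)
      assume "\<not> ?thesis"
      then have "\<rho> / 2 ^ i < 2" "1 < \<rho> / 2 ^ j" using \<phi>(2)[of "\<rho> / 2 ^ i"] \<phi>(2)[of "\<rho> / 2 ^ j"] \<rho> by fastforce+
      then have "\<rho> < 2 ^ Suc i" "2 ^ j < \<rho>" by (simp_all add: field_simps)
      moreover have "(2::real) ^ Suc i \<le> 2 ^ j" using that by (intro power_increasing) auto
      ultimately show False by linarith
    qed
    then have "\<phi> (\<rho> / 2 ^ i) = 0 \<or> \<phi> (\<rho> / 2 ^ j) = 0" if "i \<noteq> j" for i j :: nat
      using that by (metis linorder_neqE_nat)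
    then have "\<bar>\<Sum>k<N. \<nu> ^ k * \<phi> (\<rho> / 2 ^ k)\<bar> powr s = (\<Sum>k<N. \<bar>\<nu> ^ k * \<phi> (\<rho> / 2 ^ k)\<bar> powr s)"
      using s by (intro abs_sum_powr_disjoint) auto
    then show ?thesis by (simp add: F_def sum_distrib_left)
  qed
  have int: "set_integrable lborel {0<..} (F k)" for k
    unfolding F_def
  proof (rule weighted_integral_half_line(1)[OF _ _ refl a s])
    show "continuous_on {0..2 ^ Suc k} (\<lambda>\<rho>. \<nu> ^ k * \<phi> (\<rho> / 2 ^ k))"
      by (intro continuous_intros continuous_on_compose2[OF \<phi>(1)]) auto
    fix t :: real assume "2 ^ Suc k \<le> t"
    then show "\<nu> ^ k * \<phi> (t / 2 ^ k) = 0" using \<phi>(2)[of "t / 2 ^ k"] order_trans[of 0 "2 ^ Suc k" t]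
      by (simp add: field_simps)
  qed
  have scale: "(LBINT \<rho>:{0<..}. F k \<rho>) = (LBINT \<rho>:{0<..}. \<rho> powr a * \<bar>\<phi> \<rho>\<bar> powr s)" for k
  proof -
    have "(LBINT \<rho>:{0<..}. F k \<rho>) = 2 ^ k * (LBINT \<rho>. indicator {0<..} (2 ^ k * \<rho>) * F k (2 ^ k * \<rho>))"
      unfolding set_lebesgue_integral_def
      using lborel_integral_real_affine[of "2 ^ k" "\<lambda>\<rho>. indicator {0<..} \<rho> *\<^sub>R F k \<rho>" 0] by simp
    also have "\<dots> = (LBINT \<rho>. 2 ^ k * (indicator {0<..} (2 ^ k * \<rho>) * F k (2 ^ k * \<rho>)))"
      by simp
    also have "\<dots> = (LBINT \<rho>:{0<..}. \<rho> powr a * \<bar>\<phi> \<rho>\<bar> powr s)"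
      unfolding set_lebesgue_integral_def
    proof (rule Bochner_Integration.integral_cong[OF refl])
      fix \<rho> :: real
      have "(2::real) ^ k * (2 ^ k) powr a * (\<nu> ^ k) powr s = (\<nu> powr s * 2 powr (a + 1)) powr k"
        using \<nu>(1) by (simp add: powr_mult powr_powr powr_add powr_realpow[symmetric] mult_ac)
      also have "\<dots> = 1" by (simp add: \<nu>(2))
      finally have 1: "(2::real) ^ k * (2 ^ k) powr a * (\<nu> ^ k) powr s = 1" .
      have "2 ^ k * F k (2 ^ k * \<rho>) = (2 ^ k * (2 ^ k) powr a * (\<nu> ^ k) powr s) * (\<rho> powr a * \<bar>\<phi> \<rho>\<bar> powr s)"
        if "0 < \<rho>"
        using that \<nu>(1) by (simp add: F_def powr_mult abs_mult)
      then have "2 ^ k * F k (2 ^ k * \<rho>) = \<rho> powr a * \<bar>\<phi> \<rho>\<bar> powr s" if "0 < \<rho>"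
        using that unfolding 1 by simp
      then show "2 ^ k * (indicator {0<..} (2 ^ k * \<rho>) * F k (2 ^ k * \<rho>)) =
          indicator {0<..} \<rho> *\<^sub>R (\<rho> powr a * \<bar>\<phi> \<rho>\<bar> powr s)"
        by (auto simp: indicator_def zero_less_mult_iff)
    qed
    finally show ?thesis .
  qed
  have "(LBINT \<rho>:{0<..}. \<Sum>k<N. F k \<rho>) = (\<Sum>k<N. LBINT \<rho>:{0<..}. F k \<rho>)"
    using int unfolding set_lebesgue_integral_def set_integrable_def scaleR_sum_right
    by (intro Bochner_Integration.integral_sum) auto
  also have "\<dots> = real N * (LBINT \<rho>:{0<..}. \<rho> powr a * \<bar>\<phi> \<rho>\<bar> powr s)"
    by (simp add: scale)
  finally have "(LBINT \<rho>:{0<..}. \<Sum>k<N. F k \<rho>) = real N * (LBINT \<rho>:{0<..}. \<rho> powr a * \<bar>\<phi> \<rho>\<bar> powr s)" .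
  moreover have "(LBINT \<rho>:{0<..}. \<rho> powr a * \<bar>\<Sum>k<N. \<nu> ^ k * \<phi> (\<rho> / 2 ^ k)\<bar> powr s)
      = (LBINT \<rho>:{0<..}. \<Sum>k<N. F k \<rho>)"
    using split by (intro set_lebesgue_integral_cong) auto
  ultimately show ?thesis by simp
qed

text \<open>
  Both sides of the inequality are invariant under dilations that are accompanied by the right
  amplitude factor, so \<open>N\<close> disjoint dilates of one bump
  multiply the left side by \<open>N powr (1 / q)\<close> and the right side only by
  \<open>N powr (1 / p)\<close>.
\<close>
lemma no_radial_trace_ineq:
  fixes A :: "real ^ 'd" and B :: "real ^ 'r"
  assumes D: "1 \<le> hdim A" "D = hdim A" and Dr: "1 \<le> hdim B" "Dr = hdim B"
    and p: "1 \<le> p" "p < D" and q: "q < p" "q = p * Dr / (D - p)"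
  shows "\<not> radial_trace_ineq A B p q C"
proof
  assume ineq: "radial_trace_ineq A B p q C"
  have q0: "0 < q" using p Dr q by simp
  define \<phi>0 where "\<phi>0 = (\<lambda>t. flat 1 0 0 (1 * t + - 1) * flat 1 0 0 ((- 1) * t + 4))"
  have "\<phi>0 \<in> flat_algebra" unfolding \<phi>0_def by (intro flat_algebra.intros) auto
  then obtain \<phi>1 where \<phi>1: "\<phi>1 \<in> flat_algebra" "\<And>t. (\<phi>0 has_real_derivative \<phi>1 t) (at t)"
    using flat_algebra_derivative_closed unfolding derivative_closed_def by blast
  have \<phi>0_nonneg: "0 \<le> \<phi>0 t" for t by (simp add: \<phi>0_def flat_def)
  have \<phi>0_zero: "\<phi>0 t = 0" if "t \<le> 1 \<or> 4 \<le> t" for t using that by (auto simp: \<phi>0_def flat_def)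
  have \<phi>1_zero: "\<phi>1 t = 0" if "t \<le> 1 \<or> 4 \<le> t" for t
    \<comment> \<open>The zeros of the nonnegative function \<open>\<phi>0\<close> are minima.\<close>
    using \<phi>0_zero[OF that] \<phi>0_nonneg by (intro DERIV_local_min[OF \<phi>1(2), of 1]) auto
  define \<phi> where "\<phi> = (\<lambda>\<rho>. \<phi>0 (\<rho>\<^sup>2))"
  define \<phi>' where "\<phi>' = (\<lambda>\<rho>. 2 * \<rho> * \<phi>1 (\<rho>\<^sup>2))"
  have d\<phi>: "(\<phi> has_real_derivative \<phi>' \<rho>) (at \<rho>)" for \<rho>
    unfolding \<phi>_def \<phi>'_def
    by (rule DERIV_chain2[OF \<phi>1(2), THEN DERIV_cong]) (auto intro!: derivative_eq_intros)
  have c\<phi>: "continuous_on S \<phi>" for S using d\<phi> by (meson DERIV_isCont continuous_at_imp_continuous_on)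
  have c\<phi>': "continuous_on S \<phi>'" for S
    unfolding \<phi>'_def by (intro continuous_intros continuous_on_compose2[OF flat_algebra_continuous[OF \<phi>1(1)]]) auto
  have sq: "t\<^sup>2 \<le> 1 \<or> 4 \<le> t\<^sup>2" if "0 \<le> t" "t \<le> 1 \<or> 2 \<le> t" for t :: real
    using that power_mono[of 2 t 2] by (auto simp: power_le_one)
  have \<phi>_zero: "\<phi> t = 0" "\<phi>' t = 0" if "0 \<le> t" "t \<le> 1 \<or> 2 \<le> t" for t
    using \<phi>0_zero[OF sq[OF that]] \<phi>1_zero[OF sq[OF that]] by (simp_all add: \<phi>_def \<phi>'_def)
  \<comment> \<open>The amplitude that keeps the left side fixed under dilation by \<open>2\<close>.\<close>
  define \<mu> where "\<mu> = 2 powr (- ((D - p) / p))"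
  define I where "I = (LBINT \<rho>:{0<..}. \<rho> powr (Dr - 1) * \<bar>\<phi> \<rho>\<bar> powr q)"
  define J where "J = (LBINT \<rho>:{0<..}. \<rho> powr (D - 1) * \<bar>\<phi>' \<rho>\<bar> powr p)"
  have scaled: "(real N * I) powr (1 / q) \<le> C * (real N * J) powr (1 / p)" for N
  proof -
    define \<psi> where "\<psi> = (\<lambda>t. \<Sum>k<N. \<mu> ^ k * \<phi>0 (t / 4 ^ k))"
    define f where "f = (\<lambda>\<rho>. \<psi> (\<rho>\<^sup>2))"
    have "(\<lambda>t. \<phi>0 (t / 4 ^ k)) \<in> flat_algebra" for k :: nat
    proof -
      have "(\<lambda>t. \<phi>0 (t / 4 ^ k)) =
          (\<lambda>t. flat 1 0 0 (1 / 4 ^ k * t + - 1) * flat 1 0 0 (- 1 / 4 ^ k * t + 4))"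
        by (simp add: \<phi>0_def fun_eq_iff)
      also have "\<dots> \<in> flat_algebra" by (intro flat_algebra.intros) auto
      finally show ?thesis .
    qed
    then have \<psi>: "\<psi> \<in> flat_algebra"
      unfolding \<psi>_def by (intro flat_algebra_sum flat_algebra.intros)
    have "\<psi> t = 0" if t: "4 ^ N \<le> t" for t
      unfolding \<psi>_def
    proof (rule sum.neutral, rule ballI)
      fix k assume "k \<in> {..<N}"
      then have "(4::real) ^ Suc k \<le> 4 ^ N" by (intro power_increasing) auto
      with t have "4 \<le> t / 4 ^ k" by (simp add: field_simps)
      then show "\<mu> ^ k * \<phi>0 (t / 4 ^ k) = 0" using \<phi>0_zero by simp
    qed
    then have "test_function (\<lambda>z::real^'d. f (norm z))"
      unfolding f_def by (rule test_function_radial[OF flat_algebra_derivative_closed \<psi>])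
    with ineq have main: "(LBINT \<rho>:{0<..}. \<rho> powr (Dr - 1) * \<bar>f \<rho>\<bar> powr q) powr (1 / q)
        \<le> C * (LBINT \<rho>:{0<..}. \<rho> powr (D - 1) * \<bar>deriv f \<rho>\<bar> powr p) powr (1 / p)"
      unfolding radial_trace_ineq_def D Dr by blast
    have "(\<rho>::real)\<^sup>2 / 4 ^ k = (\<rho> / 2 ^ k)\<^sup>2" for \<rho> k
      by (simp add: power_divide power2_eq_square flip: power_mult_distrib)
    then have f: "f = (\<lambda>\<rho>. \<Sum>k<N. \<mu> ^ k * \<phi> (\<rho> / 2 ^ k))"
      by (simp add: f_def \<psi>_def \<phi>_def fun_eq_iff)
    have "((\<lambda>\<rho>. \<mu> ^ k * \<phi> (\<rho> / 2 ^ k)) has_real_derivative (\<mu> / 2) ^ k * \<phi>' (\<rho> / 2 ^ k)) (at \<rho>)" for k \<rho>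
    proof -
      have "((\<lambda>\<rho>. \<phi> (\<rho> / 2 ^ k)) has_real_derivative \<phi>' (\<rho> / 2 ^ k) * (1 / 2 ^ k)) (at \<rho>)"
        by (rule DERIV_chain2[OF d\<phi>]) (auto intro!: derivative_eq_intros)
      from DERIV_cmult[OF this, of "\<mu> ^ k"] show ?thesis
        by (simp add: power_divide mult_ac)
    qed
    then have "(f has_real_derivative (\<Sum>k<N. (\<mu> / 2) ^ k * \<phi>' (\<rho> / 2 ^ k))) (at \<rho>)" for \<rho>
      unfolding f by (intro DERIV_sum)
    then have f': "deriv f = (\<lambda>\<rho>. \<Sum>k<N. (\<mu> / 2) ^ k * \<phi>' (\<rho> / 2 ^ k))"
      by (auto intro: DERIV_imp_deriv)
    have "(LBINT \<rho>:{0<..}. \<rho> powr (Dr - 1) * \<bar>f \<rho>\<bar> powr q) = real N * I"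
      unfolding f I_def
    proof (rule dyadic_sum_integral[OF c\<phi> \<phi>_zero(1)])
      have "- ((D - p) / p) * q = - Dr" using p q(2) by (simp add: field_simps)
      then show "\<mu> powr q * 2 powr (Dr - 1 + 1) = 1"
        unfolding \<mu>_def powr_powr by (simp add: powr_minus)
    qed (use Dr q0 in \<open>auto simp: \<mu>_def\<close>)
    moreover have "(LBINT \<rho>:{0<..}. \<rho> powr (D - 1) * \<bar>deriv f \<rho>\<bar> powr p) = real N * J"
      unfolding f' J_def
    proof (rule dyadic_sum_integral[OF c\<phi>' \<phi>_zero(2)])
      have "\<mu> / 2 = 2 powr (- ((D - p) / p) - 1)" by (simp add: \<mu>_def powr_diff)
      moreover have "(- ((D - p) / p) - 1) * p = - D" using p by (simp add: field_simps)
      ultimately show "(\<mu> / 2) powr p * 2 powr (D - 1 + 1) = 1"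
        by (simp add: powr_powr powr_minus)
    qed (use D p in \<open>auto simp: \<mu>_def\<close>)
    ultimately show ?thesis using main by simp
  qed
  have I: "0 < I"
  proof -
    let ?F = "\<lambda>\<rho>. \<rho> powr (Dr - 1) * \<bar>\<phi> \<rho>\<bar> powr q"
    have "\<phi> t = 0" if "2 \<le> t" for t using \<phi>_zero(1)[of t] that by simp
    then have 1: "?F integrable_on {0..2}" "I = integral {0..2} ?F"
      unfolding I_def by (rule weighted_integral_half_line[OF c\<phi> _ refl]; use Dr q0 in simp)+
    have cF: "continuous_on {1..2} ?F"
      by (intro continuous_intros continuous_on_powr' c\<phi>) (use q0 in auto)
    have "integral {1..2} ?F \<noteq> 0"
    proof
      assume "integral {1..2} ?F = 0"
      then have "\<forall>x\<in>{1..2}. ?F x = 0" using integral_eq_0_iff[OF cF] by simp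
      then have "?F (3 / 2) = 0" by (rule bspec) simp
      then show False by (simp add: \<phi>_def \<phi>0_def flat_def power2_eq_square)
    qed
    moreover have "0 \<le> integral {1..2} ?F"
      by (rule Henstock_Kurzweil_Integration.integral_nonneg[OF integrable_continuous_real[OF cF]]) simp
    moreover have "integral {1..2} ?F \<le> integral {0..2} ?F"
      by (rule integral_subset_le[OF _ integrable_continuous_real[OF cF] 1(1)]) auto
    ultimately show ?thesis using 1(2) by linarith
  qed
  have J: "0 \<le> J"
    unfolding J_def set_lebesgue_integral_def by (rule Bochner_Integration.integral_nonneg) simp
  define e where "e = 1 / q - 1 / p"
  have e: "0 < e" using q(1) q0 p by (simp add: e_def field_simps)
  define K where "K = \<bar>C\<bar> * J powr (1 / p) / I powr (1 / q)"
  have K: "0 \<le> K" by (simp add: K_def)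
  obtain N :: nat where N: "(K + 1) powr (1 / e) < real N"
    using reals_Archimedean2 by blast
  have "0 < (K + 1) powr (1 / e)" using K by simp
  with N have N0: "0 < real N" by linarith
  have "real N powr (1 / q) * I powr (1 / q) \<le> C * (real N powr (1 / p) * J powr (1 / p))"
    using scaled[of N] I J by (simp add: powr_mult)
  also have "\<dots> \<le> \<bar>C\<bar> * (real N powr (1 / p) * J powr (1 / p))"
    by (intro mult_right_mono) auto
  finally have "real N powr e \<le> K"
    using N0 I by (simp add: K_def e_def powr_diff field_simps)
  moreover have "((K + 1) powr (1 / e)) powr e < real N powr e"
    using N e by (intro powr_less_mono2) auto
  then have "K + 1 < real N powr e" using e K by (simp add: powr_powr)
  ultimately show False by linarith
qed

section \<open>The optimal constant\<close>
text \<open>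
  For each test function the inequality is a closed affine condition on the constant, so the
  infimum of all admissible constants is admissible.
\<close>
lemma radial_trace_ineq_Inf:
  assumes "radial_trace_ineq A B p q C0" and "bdd_below {C. radial_trace_ineq A B p q C}"
  shows "optimal_radial_const A B p q (Inf {C. radial_trace_ineq A B p q C})" (is "optimal_radial_const A B p q (Inf ?S)")
proof -
  have "radial_trace_ineq A B p q (Inf ?S)"
    unfolding radial_trace_ineq_def[of A B p q "Inf ?S"]
  proof (intro allI impI)
    fix f :: "real \<Rightarrow> real"
    assume f: "test_function (\<lambda>z::real^'a. f (norm z))"
    define L where "L = (LBINT \<rho>:{0<..}. \<rho> powr (hdim B - 1) * \<bar>f \<rho>\<bar> powr q) powr (1 / q)"
    define X where "X = (LBINT \<rho>:{0<..}. \<rho> powr (hdim A - 1) * \<bar>deriv f \<rho>\<bar> powr p) powr (1 / p)"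
    have LX: "L \<le> C * X" if "C \<in> ?S" for C
      using that f unfolding radial_trace_ineq_def L_def X_def by blast
    have "L \<le> Inf ?S * X"
    proof (cases "X = 0")
      case True
      then show ?thesis using LX[of C0] assms(1) by simp
    next
      case False
      moreover have "0 \<le> X" by (simp add: X_def)
      ultimately have X: "0 < X" by simp
      have "L / X \<le> Inf ?S"
        using assms(1) LX X by (intro cInf_greatest) (auto simp: field_simps)
      then show ?thesis using X by (simp add: field_simps)
    qed
    then show "(LBINT \<rho>:{0<..}. \<rho> powr (hdim B - 1) * \<bar>f \<rho>\<bar> powr q) powr (1 / q)
       \<le> Inf ?S * (LBINT \<rho>:{0<..}. \<rho> powr (hdim A - 1) * \<bar>deriv f \<rho>\<bar> powr p) powr (1 / p)"
      unfolding L_def X_def .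
  qed
  then show ?thesis
    unfolding optimal_radial_const_def using assms(2) by (auto intro: cInf_lower)
qed


theorem theorem6p1:
  fixes A :: "real ^ 'd" and B :: "real ^ 'r" and D Dr p q M Q :: real
  assumes "CARD('r) < CARD('d)"
    and "\<And>j. 0 \<le> A $ j" and "\<And>i. 0 \<le> B $ i"
    and "D = real CARD('d) + (\<Sum>j\<in>UNIV. A $ j)"
    and "Dr = real CARD('r) + (\<Sum>i\<in>UNIV. B $ i)"
    and "1 \<le> p" and "p < D"
    and "q = p * Dr / (D - p)"
    and "M = Dr powr (- 1 / q) * rpow ((p - 1) / (D - p)) (1 - 1 / p)"
    and "Q = rpow (q / (q - 1)) (1 - 1 / p) * q powr (1 / q)"
  shows "(p \<le> q \<longrightarrow> (\<exists>W. optimal_radial_const A B p q W)) \<and>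
         (\<forall>W. optimal_radial_const A B p q W \<longrightarrow> M \<le> W \<and> W \<le> M * Q)"
proof -
  have hdim: "hdim A = D" "hdim B = Dr" using assms(4,5) by (simp_all add: hdim_def)
  have "(1::real) \<le> real CARD('r)" by (simp add: Suc_le_eq)
  moreover have "0 \<le> (\<Sum>i\<in>UNIV. B $ i)" by (rule sum_nonneg) (rule assms(3))
  ultimately have "1 \<le> Dr" unfolding assms(5) by linarith
  then have Dr: "1 \<le> hdim B" "Dr = hdim B" using hdim by simp_all
  have "(1::real) \<le> real CARD('d)" by (simp add: Suc_le_eq)
  moreover have "0 \<le> (\<Sum>i\<in>UNIV. A $ i)" by (rule sum_nonneg) (rule assms(2))
  ultimately have "1 \<le> D" unfolding assms(4) by linarith
  then have D: "1 \<le> hdim A" "D = hdim A" using hdim by simp_all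
  have q: "0 < q" using assms(6,7,8) Dr by simp
  have lower: "M \<le> C" if "radial_trace_ineq A B p q C" for C
  proof (cases "p = 1")
    case True
    then show ?thesis
      using radial_trace_const_lower_bound_L1[of A B q C D Dr] that D Dr q assms(9) by (simp add: rpow_def)
  next
    case False
    then show ?thesis
      using radial_trace_const_lower_bound[OF that D Dr _ assms(7) q] assms(6,9) by (simp add: rpow_def)
  qed
  have upper: "radial_trace_ineq A B p q (M * Q)" if "p \<le> q"
    unfolding assms(9,10) by (rule radial_trace_ineq_upper[OF D Dr assms(6,7) that assms(8)])
  show ?thesis
  proof (intro conjI impI allI)
    assume "p \<le> q"
    then show "\<exists>W. optimal_radial_const A B p q W"
      using radial_trace_ineq_Inf[OF upper] lower by (auto simp: bdd_below_def)
  next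
    fix W assume W: "optimal_radial_const A B p q W"
    then show "M \<le> W" by (intro lower) (simp add: optimal_radial_const_def)
    have "p \<le> q"
      using W no_radial_trace_ineq[OF D Dr assms(6,7) _ assms(8)] by (force simp: optimal_radial_const_def)
    then show "W \<le> M * Q" using W upper by (simp add: optimal_radial_const_def)
  qed
qed

end
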